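(* Let $B_1=B_1(0)\subset\mathbb{R}^n$ be the open unit ball and let $\eta(x)=1-|x|^2$. Let $f:[0,\infty)\to[0,\infty)$ be a nondecreasing function with $f(0)=0$ and $f(t)\to0$ as $t\to0^+$. Let $\psi\in C^1(B_1)$ be such that $\phi:=\psi-(n-2)\frac{\pi}{2}\ge0$ on $B_1$ and $$|D\phi(x)|\le\eta(x)\,f\!\left(\eta(x)^{-2}\phi(x)\right)\qquad\text{for all }x\in B_1.$$ Let $u\in C^3(\overline{B_1})$ be a solution of $$\sum_{i=1}^n\arctan\lambda_i(x)=\psi(x),\qquad x\in B_1,$$ where $\lambda_1(x),\dots,\lambda_n(x)$ are the eigenvalues of the Hessian $D^2u(x)$. Then $$|Du(0)|\le C(n,f,\operatorname{osc}_{B_1}u),$$ where the constant depends only on $n$, $f$ and $\operatorname{osc}_{B_1}u$.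
   Context: $\operatorname{osc}_{B_1}u=\sup_{B_1}u-\inf_{B_1}u$. *)

theory Defs
  imports "HOL-Analysis.Analysis" "HOL-Computational_Algebra.Polynomial"
begin

definition partial_deriv :: "'n \<Rightarrow> (real^'n \<Rightarrow> real) \<Rightarrow> real^'n \<Rightarrow> real" where
  "partial_deriv i g x = frechet_derivative g (at x) (axis i 1)"

fun partial_derivs :: "'n list \<Rightarrow> (real^'n \<Rightarrow> real) \<Rightarrow> real^'n \<Rightarrow> real" where
  "partial_derivs [] g = g"
| "partial_derivs (i # is) g = partial_deriv i (partial_derivs is g)"

text \<open>The class \<open>C\<^sup>k(U)\<close> for open \<open>U\<close>. Differentiability of the derivatives of order below
  \<open>k\<close> is required explicitly because \<^const>\<open>frechet_derivative\<close> is total.\<close>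

definition Ck_on :: "nat \<Rightarrow> (real^'n) set \<Rightarrow> (real^'n \<Rightarrow> real) \<Rightarrow> bool" where
  "Ck_on k U g \<longleftrightarrow>
     (\<forall>is. length is < k \<longrightarrow> (\<forall>x\<in>U. partial_derivs is g differentiable (at x))) \<and>
     (\<forall>is. length is \<le> k \<longrightarrow> continuous_on U (partial_derivs is g))"

text \<open>The class \<open>C\<^sup>k\<close> on the closure of an open \<open>U\<close>: derivatives are taken in \<open>U\<close> only and
  extend continuously to the closure. Values of \<open>g\<close> outside the closure play no role.\<close>

definition Ck_on_closure :: "nat \<Rightarrow> (real^'n) set \<Rightarrow> (real^'n \<Rightarrow> real) \<Rightarrow> bool" where
  "Ck_on_closure k U g \<longleftrightarrow>
     Ck_on k U g \<and> continuous_on (closure U) g \<and>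
     (\<forall>is. length is \<le> k \<longrightarrow>
        (\<exists>h. continuous_on (closure U) h \<and> (\<forall>x\<in>U. h x = partial_derivs is g x)))"

definition grad :: "(real^'n \<Rightarrow> real) \<Rightarrow> real^'n \<Rightarrow> real^'n" where
  "grad g x = (\<chi> i. partial_deriv i g x)"

definition hessian :: "(real^'n \<Rightarrow> real) \<Rightarrow> real^'n \<Rightarrow> real^'n^'n" where
  "hessian g x = (\<chi> i j. partial_deriv i (partial_deriv j g) x)"

definition charpoly :: "real^'n^'n \<Rightarrow> real poly" where
  "charpoly A = det (mat [:0, 1:] - (\<chi> i j. [:A $ i $ j:]))"

text \<open>Eigenvalues are counted with algebraic multiplicity; a symmetric matrix thus has exactly
  \<open>CARD('n)\<close> of them.\<close>

definition eigenvalues :: "real^'n^'n \<Rightarrow> real multiset" where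
  "eigenvalues A = proots (charpoly A)"

definition osc :: "(real^'n) set \<Rightarrow> (real^'n \<Rightarrow> real) \<Rightarrow> real" where
  "osc S g = (SUP x\<in>S. g x) - (INF x\<in>S. g x)"

definition eta :: "real^'n \<Rightarrow> real" where
  "eta x = 1 - (norm x)\<^sup>2"

end

theory Submission
  imports Defs
begin

text \<open>The bound comes from the maximum principle applied to
\<open>Q = \<eta> |Du| + A/2 (u - inf u + 1)\<^sup>2\<close> with \<open>A = 2n + 1\<close>. The quadratic term is bounded in terms of
\<open>osc u\<close>, so if \<open>|Du(0)|\<close> is huge, then \<open>Q\<close> has an interior maximum point \<open>x\<close>, and \<open>\<eta> |Du|\<close> is
still large there. Write \<open>p = |Du(x)|\<close>, \<open>e = Du(x)/p\<close>, let \<open>b\<^sub>i\<close> be an orthonormal eigenbasis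
of \<open>D\<^sup>2u(x)\<close> with eigenvalues \<open>\<lambda>\<^sub>i\<close>, and put \<open>e\<^sub>i = \<langle>e, b\<^sub>i\<rangle>\<close>.

First order. Some \<open>e\<^sub>k\<close> has \<open>e\<^sub>k\<^sup>2 \<ge> 1/n\<close>, and the vanishing of \<open>D Q\<close> in the direction \<open>b\<^sub>k\<close> forces
\<open>\<lambda>\<^sub>k\<close> to be negative and of size comparable to \<open>p/\<eta>\<close>. Since the phase is at least
\<open>(n - 2) \<pi>/2\<close>, all other eigenvalues are then at least \<open>|\<lambda>\<^sub>k|\<close>; so among the coefficients
\<open>1/(1 + \<lambda>\<^sub>i\<^sup>2)\<close> of the linearized operator the one of the direction \<open>b\<^sub>k\<close>, in which \<open>u\<close> has a
definite part of its gradient, is the largest. For the same reason \<open>\<phi> \<le> 1/|\<lambda>\<^sub>k| \<le> \<eta>/p\<close>.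

Second order. Summing the second derivatives of \<open>Q\<close> along the \<open>b\<^sub>i\<close> with these coefficients, the
third derivatives of \<open>u\<close> combine to \<open>\<langle>D\<phi>, e\<rangle>\<close> by the differentiated equation, and the term
\<open>A |Du|\<^sup>2\<close> from the square of \<open>u\<close> beats all the others. What remains is
\<open>c \<eta> \<le> |D\<phi>|\<close> with \<open>c\<close> depending on \<open>n\<close> and \<open>osc u\<close> only (\<open>critical_point_inequality\<close>).
But \<open>|D\<phi>| \<le> \<eta> f(\<phi>/\<eta>\<^sup>2) \<le> \<eta> f(1/(\<eta> p))\<close>, and \<open>f(1/(\<eta> p)) < c\<close> once \<open>\<eta> p\<close> is large.

Two devices keep the calculus elementary. At the maximum \<open>|Du|\<close> is replaced by \<open>\<langle>Du, e\<rangle>\<close> with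
\<open>e\<close> frozen: this lies below \<open>|Du|\<close> and agrees with it at \<open>x\<close>, so \<open>x\<close> remains a maximum and all
derivatives can be taken along lines (\<open>interior_maximum_estimate\<close>). And the spectral function
\<open>\<Sum> arctan \<lambda>\<^sub>i\<close> is differentiated without perturbation theory for eigenvalues: it is, up to a
constant, an argument of the polynomial expression \<open>det (\<i> I - D\<^sup>2u)\<close> (\<open>phase_derivative\<close>).\<close>

section \<open>Symmetric matrices and their eigenvalues\<close>

definition diag_matrix :: "('n \<Rightarrow> 'a::zero) \<Rightarrow> 'a^'n^'n" where
  "diag_matrix d = (\<chi> i j. if i = j then d i else 0)"

lemma quadratic_nonneg_imp_zero:
  fixes c d :: real
  assumes "\<And>t. 0 \<le> t\<^sup>2 * d + 2 * t * c"
  shows "c = 0"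
proof (rule ccontr)
  assume c: "c \<noteq> 0"
  have d: "d \<ge> 0" using assms[of 1] assms[of "-1"] by simp
  define e where "e = d + 1"
  have e: "d = e - 1" "e \<ge> 1" using d by (auto simp: e_def)
  have "0 \<le> (c / e)\<^sup>2 * d - 2 * (c / e) * c"
    using assms[of "- c / e"] by (simp add: power_divide)
  also have "\<dots> = - (c\<^sup>2 * (e + 1) / e\<^sup>2)"
    using e(2) unfolding e(1) by (simp add: field_simps power2_eq_square)
  also have "\<dots> < 0" using c e by simp
  finally show False by simp
qed

lemma symmetric_dot:
  fixes A :: "real^'n^'n"
  assumes "transpose A = A"
  shows "(A *v x) \<bullet> y = x \<bullet> (A *v y)"
  by (metis assms dot_lmul_matrix inner_commute transpose_matrix_vector)

text \<open>A maximizer \<open>x\<close> of the Rayleigh quotient on \<open>W\<close>, with value \<open>c\<close>, makes the form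
\<open>c \<langle>z,z\<rangle> - \<langle>z,Az\<rangle>\<close> nonnegative on \<open>W\<close> and zero at \<open>x\<close>, so its derivative at \<open>x\<close> vanishes in every
direction of \<open>W\<close>; the direction \<open>Ax - cx\<close>, which lies in \<open>W\<close> by invariance, gives \<open>Ax = cx\<close>.\<close>

lemma symmetric_eigenvector_exists:
  fixes A :: "real^'n^'n"
  assumes sym: "transpose A = A" and W: "subspace W" "\<And>x. x \<in> W \<Longrightarrow> A *v x \<in> W"
    and nz: "w \<in> W" "w \<noteq> 0"
  obtains x c where "x \<in> W" "norm x = 1" "A *v x = c *\<^sub>R x"
proof -
  let ?S = "sphere 0 1 \<inter> W"
  have "compact ?S"
    using closed_subspace[OF W(1)] compact_Int_closed[OF compact_sphere] by blast
  moreover have "(1 / norm w) *\<^sub>R w \<in> ?S"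
    using nz W(1) by (auto simp: subspace_scale)
  moreover have "continuous_on ?S (\<lambda>x. x \<bullet> (A *v x))"
    by (intro continuous_intros linear_continuous_on_compose[OF continuous_on_id]) auto
  ultimately obtain x where x: "x \<in> ?S" and xmax: "\<And>y. y \<in> ?S \<Longrightarrow> y \<bullet> (A *v y) \<le> x \<bullet> (A *v x)"
    using continuous_attains_sup[of ?S "\<lambda>x. x \<bullet> (A *v x)"] by blast
  define c where "c = x \<bullet> (A *v x)"
  have xn: "norm x = 1" "x \<in> W" using x by auto
  have nn: "z \<bullet> (A *v z) \<le> c * (z \<bullet> z)" if "z \<in> W" for z
  proof (cases "z = 0")
    case False
    then have "(1 / norm z) *\<^sub>R z \<in> ?S" using that W(1) by (auto simp: subspace_scale)
    from xmax[OF this] have "(z \<bullet> (A *v z)) / (norm z)\<^sup>2 \<le> c"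
      by (simp add: c_def matrix_vector_mult_scaleR power2_eq_square)
    then show ?thesis using False by (simp add: divide_simps power2_norm_eq_inner mult.commute)
  qed auto
  \<comment> \<open>First variation of the nonnegative quadratic form at its zero \<open>x\<close>.\<close>
  have orth: "c * (x \<bullet> y) - y \<bullet> (A *v x) = 0" if y: "y \<in> W" for y
  proof (rule quadratic_nonneg_imp_zero)
    fix t :: real
    have "x + t *\<^sub>R y \<in> W" using y xn W(1) by (auto simp: subspace_add subspace_scale)
    from nn[OF this]
    have "0 \<le> c * ((x + t *\<^sub>R y) \<bullet> (x + t *\<^sub>R y)) - (x + t *\<^sub>R y) \<bullet> (A *v (x + t *\<^sub>R y))"
      by simp
    also have "\<dots> = t\<^sup>2 * (c * (y \<bullet> y) - y \<bullet> (A *v y)) + 2 * t * (c * (x \<bullet> y) - y \<bullet> (A *v x))"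
      using symmetric_dot[OF sym, of x y] xn
      by (simp add: inner_simps matrix_vector_mult_scaleR matrix_vector_right_distrib algebra_simps
          power2_eq_square c_def inner_commute norm_eq_1)
    finally show "0 \<le> t\<^sup>2 * (c * (y \<bullet> y) - y \<bullet> (A *v y)) + 2 * t * (c * (x \<bullet> y) - y \<bullet> (A *v x))" .
  qed
  define y where "y = A *v x - c *\<^sub>R x"
  have "y \<in> W" unfolding y_def using W xn by (simp add: subspace_diff subspace_scale)
  from orth[OF this] have "y \<bullet> y = 0" by (simp add: y_def inner_simps inner_commute algebra_simps)
  then have "A *v x = c *\<^sub>R x" by (simp add: y_def)
  with xn that show thesis by blast
qed

text \<open>The spectral theorem. An orthonormal set of eigenvectors of maximal cardinality must span, because
its orthogonal complement is invariant and would otherwise contain a further eigenvector.\<close>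

lemma symmetric_orthonormal_eigenbasis:
  fixes A :: "real^'n^'n"
  assumes sym: "transpose A = A"
  obtains P d where "orthogonal_matrix P" "\<And>i. A *v column i P = d i *\<^sub>R column i P"
proof -
  define good where "good B \<longleftrightarrow> pairwise orthogonal B \<and>
    (\<forall>b\<in>B. norm b = 1 \<and> (\<exists>c. A *v b = c *\<^sub>R b))" for B
  have indep: "independent B" if "good B" for B
    by (rule pairwise_orthogonal_independent) (use that in \<open>auto simp: good_def\<close>)
  have fin: "finite B" "card B \<le> CARD('n)" if "good B" for B
    using independent_bound[OF indep[OF that]] by auto
  have ex: "good {}" by (simp add: good_def)
  obtain B where B: "good B" and Bmax: "\<And>C. good C \<Longrightarrow> card C \<le> card B"
    using ex_has_greatest_nat[of good "{}" card "Suc CARD('n)"] ex fin by (auto simp: less_Suc_eq_le)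
  have "span B = UNIV"
  proof (rule ccontr)
    assume "span B \<noteq> UNIV"
    then obtain w where w: "w \<noteq> 0" "\<And>x. x \<in> span B \<Longrightarrow> orthogonal w x"
      using orthogonal_to_subspace_exists_gen[of B UNIV] by (metis UNIV_I orthogonal_to_subspace_exists_gen span_UNIV top.not_eq_extremum)
    define W where "W = {y. \<forall>b\<in>B. b \<bullet> y = 0}"
    have sW: "subspace W" by (auto simp: W_def subspace_def inner_simps)
    have inv: "A *v y \<in> W" if "y \<in> W" for y
    proof -
      have "b \<bullet> (A *v y) = 0" if b: "b \<in> B" for b
      proof -
        obtain c where "A *v b = c *\<^sub>R b" using b B by (auto simp: good_def)
        then show ?thesis
          using \<open>y \<in> W\<close> b symmetric_dot[OF sym, of b y] by (simp add: W_def)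
      qed
      then show ?thesis by (simp add: W_def)
    qed
    have "w \<in> W" using w(2) by (auto simp: W_def orthogonal_def span_base inner_commute)
    with symmetric_eigenvector_exists[OF sym sW inv _ w(1)]
    obtain x c where x: "x \<in> W" "norm x = 1" "A *v x = c *\<^sub>R x" by metis
    have "x \<notin> B" using x by (auto simp: W_def)
    moreover have "good (insert x B)"
      using B x by (auto simp: good_def pairwise_insert W_def orthogonal_def inner_commute)
    ultimately show False using Bmax[of "insert x B"] fin[OF B] by simp
  qed
  then have cB: "card B = CARD('n)"
    using indep[OF B] by (metis DIM_cart DIM_real dim_UNIV dim_span dim_eq_card_independent mult.right_neutral)
  obtain h :: "'n \<Rightarrow> real^'n" where h: "bij_betw h UNIV B"
    using finite_same_card_bij[of "UNIV :: 'n set" B] fin[OF B] cB by auto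
  define P where "P = (\<chi> i j. h j $ i)"
  have col: "column i P = h i" for i by (simp add: P_def column_def)
  have hB: "h i \<in> B" for i using h by (auto simp: bij_betw_def)
  have "orthogonal_matrix P"
    using hB B h unfolding orthogonal_matrix_orthonormal_columns col good_def pairwise_def
    by (metis UNIV_I bij_betw_def inj_onD)
  moreover have "\<exists>d. \<forall>i. A *v column i P = d i *\<^sub>R column i P"
    using hB B by (intro choice) (auto simp: good_def col)
  ultimately show thesis using that by blast
qed

lemma orthogonal_matrix_inner_columns:
  fixes P :: "real^'n^'n"
  assumes "orthogonal_matrix P"
  shows "column i P \<bullet> column j P = (if i = j then 1 else 0)"
  using assms unfolding orthogonal_matrix_orthonormal_columns
  by (auto simp: norm_eq_1 orthogonal_def)

lemma conjugated_entry:
  fixes P :: "real^'n^'n"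
  shows "(transpose P ** A ** P) $ i $ j = column i P \<bullet> (A *v column j P)"
proof -
  have "(transpose P ** A ** P) = transpose P ** (A ** P)" by (simp add: matrix_mul_assoc)
  then show ?thesis
    by (simp add: matrix_matrix_mult_def transpose_def column_def inner_vec_def matrix_vector_mult_def)
qed

lemma eigenbasis_diagonalizes:
  fixes P :: "real^'n^'n"
  assumes "orthogonal_matrix P" "\<And>i. A *v column i P = d i *\<^sub>R column i P"
  shows "transpose P ** A ** P = diag_matrix d"
  using orthogonal_matrix_inner_columns[OF assms(1)] assms(2)
  by (intro vec_eq_iff[THEN iffD2] allI) (simp add: conjugated_entry diag_matrix_def)

text \<open>The ring homomorphism \<open>c\<close> is arbitrary so that the same computation gives the characteristic
polynomial (\<open>c\<close> the constant polynomials, \<open>z\<close> the indeterminate) and the complex number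
\<open>det (\<i> I - A)\<close> (\<open>c\<close> the embedding of the reals, \<open>z = \<i>\<close>).\<close>

lemma det_diagonalized:
  fixes P :: "real^'n^'n" and c :: "real \<Rightarrow> 'a::comm_ring_1"
  assumes P: "orthogonal_matrix P" and A: "transpose P ** A ** P = diag_matrix d"
    and c: "c 0 = 0" "c 1 = 1" "\<And>x y. c (x + y) = c x + c y" "\<And>x y. c (x * y) = c x * c y"
  shows "det (mat z - (\<chi> i j. c (A $ i $ j))) = (\<Prod>i\<in>UNIV. z - c (d i))"
proof -
  define m where "m M = (\<chi> i j. c (M $ i $ j))" for M :: "real^'n^'n"
  have csum: "c (sum f S) = (\<Sum>x\<in>S. c (f x))" for f and S :: "'n set"
    by (induction S rule: infinite_finite_induct) (auto simp: c)
  have mm: "m (M ** N) = m M ** m N" for M N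
    by (simp add: m_def matrix_matrix_mult_def csum c)
  have m1: "m (mat 1) = mat 1" by (simp add: m_def mat_def vec_eq_iff c)
  have mdiag: "mat z - m (diag_matrix d) = diag_matrix (\<lambda>i. z - c (d i))"
    by (simp add: m_def mat_def diag_matrix_def vec_eq_iff c)
  have matz: "mat z ** M = M ** mat z" for M :: "'a^'n^'n"
    by (simp add: matrix_matrix_mult_def mat_def vec_eq_iff if_distrib if_distribR mult.commute cong: if_cong)
  have PP: "m (transpose P) ** m P = mat 1"
    using P by (simp add: orthogonal_matrix flip: mm m1)
  have "diag_matrix (\<lambda>i. z - c (d i)) = mat z - m (transpose P) ** m A ** m P"
    by (simp flip: mdiag add: mm A[symmetric])
  also have "\<dots> = m (transpose P) ** mat z ** m P - m (transpose P) ** m A ** m P"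
    by (metis PP matz matrix_mul_assoc matrix_mul_rid)
  also have "\<dots> = m (transpose P) ** (mat z - m A) ** m P"
    by (simp add: matrix_matrix_mult_def vec_eq_iff algebra_simps sum_subtractf)
  finally have "det (diag_matrix (\<lambda>i. z - c (d i))) = det (m (transpose P) ** m P) * det (mat z - m A)"
    by (simp add: det_mul)
  also have "\<dots> = det (mat z - m A)" by (simp add: PP)
  finally show ?thesis
    by (simp add: m_def diag_matrix_def det_diagonal)
qed

lemma eigenvalues_diagonalized:
  fixes P :: "real^'n^'n"
  assumes "orthogonal_matrix P" "transpose P ** A ** P = diag_matrix d"
  shows "eigenvalues A = image_mset d (mset_set UNIV)"
proof -
  have "charpoly A = (\<Prod>i\<in>UNIV. [:0, 1:] - [:d i:])"
    unfolding charpoly_def by (rule det_diagonalized[OF assms]) (auto simp: one_pCons)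
  then have "eigenvalues A = (\<Sum>i\<in>UNIV. proots [:- d i, 1:])"
    by (simp add: eigenvalues_def proots_prod)
  also have "\<dots> = (\<Sum>i\<in>UNIV. {#d i#})" by simp
  also have "\<dots> = image_mset d (mset_set UNIV)"
    by (simp add: sum_unfold_sum_mset) 
  finally show ?thesis .
qed

lemma sum_eigenvalues:
  fixes P :: "real^'n^'n"
  assumes "orthogonal_matrix P" "\<And>i. A *v column i P = d i *\<^sub>R column i P"
  shows "(\<Sum>l\<in>#eigenvalues A. h l) = (\<Sum>i\<in>UNIV. h (d i))"
  using eigenvalues_diagonalized[OF assms(1) eigenbasis_diagonalizes[OF assms]]
  by (simp add: sum_unfold_sum_mset image_mset.compositionality comp_def)

section \<open>Differentiating the phase\<close>

lemma i_minus_real_polar: "\<i> - complex_of_real l = complex_of_real (sqrt (1 + l\<^sup>2)) * cis (pi / 2 + arctan l)"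
proof -
  have "sqrt (1 + l\<^sup>2) > 0" by (simp add: add_pos_nonneg)
  then show ?thesis
    by (simp add: complex_eq_iff cos_add sin_add cos_arctan sin_arctan)
qed

lemma prod_cis: "finite S \<Longrightarrow> (\<Prod>i\<in>S. cis (t i)) = cis (\<Sum>i\<in>S. t i)"
  by (induction S rule: finite_induct) (auto simp: cis_mult)

text \<open>The number \<open>\<Sum> arctan \<lambda>\<^sub>i + n \<pi>/2\<close> is an argument of \<open>det (\<i> I - A)\<close>. The conjugation by \<open>Q\<close>
leaves the determinant unchanged; it allows a fixed basis to be chosen in which the matrix at the
base point, but not the nearby ones, is diagonal.\<close>

lemma det_polar:
  fixes A Q :: "real^'n^'n"
  assumes sym: "transpose A = A" and Q: "orthogonal_matrix Q"
  obtains R where "R > 0"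
    "det (mat \<i> - (\<chi> i j. complex_of_real ((transpose Q ** A ** Q) $ i $ j)))
       = complex_of_real R * cis (real CARD('n) * (pi / 2) + (\<Sum>l\<in>#eigenvalues A. arctan l))"
proof -
  obtain P d where P: "orthogonal_matrix P" "\<And>i. A *v column i P = d i *\<^sub>R column i P"
    using symmetric_orthonormal_eigenbasis[OF sym] by metis
  define S where "S = transpose Q ** P"
  have S: "orthogonal_matrix S"
    unfolding S_def using Q P(1) by (simp add: orthogonal_matrix_mul)
  have QQ: "Q ** transpose Q = mat 1" using Q by (simp add: orthogonal_matrix_def)
  have "transpose S ** (transpose Q ** A ** Q) ** S
      = transpose P ** ((Q ** transpose Q) ** A ** (Q ** transpose Q)) ** P"
    by (simp add: S_def matrix_transpose_mul matrix_mul_assoc)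
  also have "\<dots> = diag_matrix d"
    using eigenbasis_diagonalizes[OF P] by (simp add: QQ)
  finally have D: "transpose S ** (transpose Q ** A ** Q) ** S = diag_matrix d" .
  have "det (mat \<i> - (\<chi> i j. complex_of_real ((transpose Q ** A ** Q) $ i $ j)))
      = (\<Prod>i\<in>UNIV. \<i> - complex_of_real (d i))"
    by (rule det_diagonalized[OF S D]) auto
  also have "\<dots> = complex_of_real (\<Prod>i\<in>UNIV. sqrt (1 + (d i)\<^sup>2)) *
      cis (\<Sum>i\<in>UNIV. pi / 2 + arctan (d i))"
    by (simp add: i_minus_real_polar prod.distrib prod_cis)
  also have "(\<Sum>i\<in>UNIV. pi / 2 + arctan (d i))
      = real CARD('n) * (pi / 2) + (\<Sum>l\<in>#eigenvalues A. arctan l)"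
    by (simp add: sum_eigenvalues[OF P] sum.distrib)
  finally show thesis
    by (rule that[rotated]) (auto intro!: prod_pos simp: add_pos_nonneg)
qed

text \<open>A permutation other than the identity moves at least two indices, so its product in the Leibniz
formula contains two off-diagonal factors and vanishes to second order at a diagonal matrix.\<close>

lemma det_has_derivative_at_diagonal:
  fixes M :: "real \<Rightarrow> complex^'n^'n"
  assumes der: "\<And>i j. ((\<lambda>t. M t $ i $ j) has_vector_derivative N i j) (at t)"
    and diag: "\<And>i j. i \<noteq> j \<Longrightarrow> M t $ i $ j = 0"
  shows "((\<lambda>t. det (M t)) has_vector_derivative
     (\<Sum>j\<in>UNIV. N j j * (\<Prod>k\<in>UNIV - {j}. M t $ k $ k))) (at t)"
proof -
  let ?T = "\<lambda>p. (\<Sum>j\<in>UNIV. N j (p j) * (\<Prod>k\<in>UNIV - {j}. M t $ k $ p k))"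
  have prod: "((\<lambda>t. \<Prod>i\<in>UNIV. M t $ i $ p i) has_vector_derivative ?T p) (at t)" for p
  proof -
    have "((\<lambda>t. \<Prod>i\<in>UNIV. M t $ i $ p i) has_derivative
       (\<lambda>y. \<Sum>i\<in>UNIV. (y *\<^sub>R N i (p i)) * (\<Prod>j\<in>UNIV - {i}. M t $ j $ p j))) (at t)"
      by (rule has_derivative_prod) (use der in \<open>simp add: has_vector_derivative_def\<close>)
    then show ?thesis
      unfolding has_vector_derivative_def by (simp add: scaleR_sum_right)
  qed
  have zero: "?T p = 0" if p: "p permutes UNIV" "p \<noteq> id" for p :: "'n \<Rightarrow> 'n"
  proof (rule sum.neutral, rule ballI)
    fix j
    have "\<exists>k. k \<noteq> j \<and> p k \<noteq> k"
    proof (rule ccontr)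
      assume "\<not> ?thesis"
      then have fixd: "p k = k" if "k \<noteq> j" for k using that by blast
      have "p j = j"
        by (metis fixd p(1) permutes_def)
      with fixd have "p = id" by (metis eq_id_iff)
      with p show False by simp
    qed
    then obtain k where "k \<noteq> j" "p k \<noteq> k" by blast
    then have "(\<Prod>k\<in>UNIV - {j}. M t $ k $ p k) = 0"
      by (intro prod_zero) (auto intro!: bexI[of _ k] diag)
    then show "N j (p j) * (\<Prod>k\<in>UNIV - {j}. M t $ k $ p k) = 0" by simp
  qed
  have "((\<lambda>t. det (M t)) has_vector_derivative
     (\<Sum>p\<in>{p. p permutes UNIV}. of_int (sign p) * ?T p)) (at t)"
    unfolding det_def by (intro has_vector_derivative_sum has_vector_derivative_mult_right prod)
  also have "(\<Sum>p\<in>{p. p permutes UNIV}. of_int (sign p) * ?T p)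
     = (\<Sum>p\<in>{id}. of_int (sign p) * ?T p)"
    by (rule sum.mono_neutral_right) (auto simp: permutes_id zero)
  finally show ?thesis by simp
qed

text \<open>Multiplying \<open>det (\<i> I - H(t))\<close> by \<open>e\<^sup>-\<^sup>i\<^sup>\<theta>\<close>, where \<open>\<theta> = n \<pi>/2 + \<psi>\<close>, makes it a positive real, so the
imaginary part of the product is constantly zero. Differentiating this identity at \<open>t = 0\<close>, where
the matrix is diagonal, gives the derivative of \<open>\<psi>\<close>; the weights are the imaginary parts
\<open>1/(1 + d\<^sup>2)\<close> of \<open>- 1/(\<i> - d)\<close>.\<close>

lemma phase_derivative:
  fixes H :: "real \<Rightarrow> real^'n^'n" and P :: "real^'n^'n"
  assumes ev: "eventually (\<lambda>t. transpose (H t) = H t \<and> (\<Sum>l\<in>#eigenvalues (H t). arctan l) = \<psi> t) (nhds 0)"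
    and dH: "\<And>i j. ((\<lambda>t. column i P \<bullet> (H t *v column j P)) has_real_derivative K i j) (at 0)"
    and d\<psi>: "(\<psi> has_real_derivative \<psi>') (at 0)"
    and P: "orthogonal_matrix P" "\<And>i. H 0 *v column i P = d i *\<^sub>R column i P"
  shows "\<psi>' = (\<Sum>i\<in>UNIV. K i i / (1 + (d i)\<^sup>2))"
proof -
  define M where "M t = mat \<i> - (\<chi> i j. complex_of_real ((transpose P ** H t ** P) $ i $ j))" for t
  define \<theta> where "\<theta> t = real CARD('n) * (pi / 2) + \<psi> t" for t
  have M0: "M 0 $ i $ j = (if i = j then \<i> - d i else 0)" for i j
    using eigenbasis_diagonalizes[OF P] by (simp add: M_def diag_matrix_def mat_def)
  have dM: "((\<lambda>t. M t $ i $ j) has_vector_derivative - complex_of_real (K i j)) (at 0)" for i j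
  proof -
    have "((\<lambda>t. mat \<i> $ i $ j - complex_of_real (column i P \<bullet> (H t *v column j P)))
        has_vector_derivative 0 - complex_of_real (K i j)) (at 0)"
      by (intro derivative_intros has_vector_derivative_of_real dH)
    then show ?thesis by (simp add: M_def conjugated_entry)
  qed
  have nz: "\<i> - complex_of_real r \<noteq> 0" for r by (simp add: complex_eq_iff)
  have rec: "- 1 / (\<i> - complex_of_real r) = (of_real r + \<i>) / of_real (1 + r\<^sup>2)" for r
  proof -
    have *: "complex_of_real (1 + r\<^sup>2) \<noteq> 0"
      by (metis add_pos_nonneg less_irrefl of_real_eq_0_iff zero_le_power2 zero_less_one)
    have "- 1 * complex_of_real (1 + r\<^sup>2) = (of_real r + \<i>) * (\<i> - of_real r)"
      by (simp add: complex_eq_iff power2_eq_square algebra_simps)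
    then show ?thesis using frac_eq_eq[OF nz *] by blast
  qed
  define s where "s = (\<Sum>j\<in>UNIV. complex_of_real (K j j) * ((of_real (d j) + \<i>) / of_real (1 + (d j)\<^sup>2)))"
  have det0: "det (M 0) = (\<Prod>k\<in>UNIV. \<i> - d k)"
    using M0 by (subst det_diagonal) auto
  have dF: "((\<lambda>t. det (M t)) has_vector_derivative det (M 0) * s) (at 0)"
  proof -
    have "((\<lambda>t. det (M t)) has_vector_derivative
       (\<Sum>j\<in>UNIV. - complex_of_real (K j j) * (\<Prod>k\<in>UNIV - {j}. M 0 $ k $ k))) (at 0)"
      by (rule det_has_derivative_at_diagonal[OF dM]) (simp add: M0)
    also have "(\<Sum>j\<in>UNIV. - complex_of_real (K j j) * (\<Prod>k\<in>UNIV - {j}. M 0 $ k $ k)) = det (M 0) * s"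
      unfolding s_def sum_distrib_left
    proof (rule sum.cong[OF refl])
      fix j
      have "det (M 0) = (\<i> - d j) * (\<Prod>k\<in>UNIV - {j}. M 0 $ k $ k)"
        unfolding det0 by (subst prod.remove[of _ j]) (auto simp: M0)
      then show "- complex_of_real (K j j) * (\<Prod>k\<in>UNIV - {j}. M 0 $ k $ k) =
         det (M 0) * (complex_of_real (K j j) * ((of_real (d j) + \<i>) / of_real (1 + (d j)\<^sup>2)))"
        unfolding rec[symmetric] using nz[of "d j"] by simp
    qed
    finally show ?thesis .
  qed
  have dcis: "((\<lambda>t. cis (- \<theta> t)) has_vector_derivative (- \<psi>') *\<^sub>R (\<i> * cis (- \<theta> 0))) (at 0)"
  proof -
    have "(\<theta> has_real_derivative \<psi>') (at 0)"
      unfolding \<theta>_def using d\<psi> by (auto intro!: derivative_eq_intros)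
    then have 1: "((\<lambda>t. - \<theta> t) has_vector_derivative - \<psi>') (at 0)"
      unfolding has_real_derivative_iff_has_vector_derivative[symmetric] by (rule DERIV_minus)
    have 2: "(cis has_vector_derivative \<i> * cis (- \<theta> 0)) (at (- \<theta> 0))"
      unfolding has_vector_derivative_def by (auto intro!: derivative_eq_intros simp: scaleR_conv_of_real)
    show ?thesis using vector_diff_chain_at[OF 1 2] by (simp add: comp_def)
  qed
  let ?G = "\<lambda>t. cis (- \<theta> t) * det (M t)"
  have dG: "(?G has_vector_derivative
      cis (- \<theta> 0) * (det (M 0) * s) + ((- \<psi>') *\<^sub>R (\<i> * cis (- \<theta> 0))) * det (M 0)) (at 0)"
    by (rule has_vector_derivative_mult[OF dcis dF])
  have pol: "\<exists>R>0. ?G t = complex_of_real R"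
    if sym: "transpose (H t) = H t" and phase: "(\<Sum>l\<in>#eigenvalues (H t). arctan l) = \<psi> t" for t
  proof -
    obtain R where "R > 0" "det (M t) = complex_of_real R * cis (\<theta> t)"
      using det_polar[OF sym P(1)] phase unfolding M_def \<theta>_def by metis
    then show ?thesis by (auto simp: cis_mult mult.commute mult.left_commute intro!: exI[of _ R])
  qed
  have "eventually (\<lambda>t. Im (?G t) = 0) (nhds 0)"
    by (rule eventually_mono[OF ev]) (metis pol Im_complex_of_real)
  moreover have "((\<lambda>t. Im (?G t)) has_real_derivative
      Im (cis (- \<theta> 0) * (det (M 0) * s) + ((- \<psi>') *\<^sub>R (\<i> * cis (- \<theta> 0))) * det (M 0))) (at 0)"
    unfolding has_real_derivative_iff_has_vector_derivative
    using bounded_linear.has_vector_derivative[OF bounded_linear_Im dG] .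
  ultimately have "((\<lambda>t. 0) has_real_derivative
      Im (cis (- \<theta> 0) * (det (M 0) * s) + ((- \<psi>') *\<^sub>R (\<i> * cis (- \<theta> 0))) * det (M 0))) (at 0)"
    by (subst (asm) DERIV_cong_ev[OF refl _ refl, where g = "\<lambda>t. 0"]) auto
  then have Im0: "Im (cis (- \<theta> 0) * (det (M 0) * s) + ((- \<psi>') *\<^sub>R (\<i> * cis (- \<theta> 0))) * det (M 0)) = 0"
    using DERIV_const DERIV_unique by blast
  obtain R where R: "R > 0" "?G 0 = complex_of_real R"
    using pol eventually_nhds_x_imp_x[OF ev] by blast
  have "cis (- \<theta> 0) * (det (M 0) * s) + ((- \<psi>') *\<^sub>R (\<i> * cis (- \<theta> 0))) * det (M 0)
     = ?G 0 * (s - of_real \<psi>' * \<i>)"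
    by (simp add: scaleR_conv_of_real algebra_simps)
  then have "R * (Im s - \<psi>') = 0" using Im0 by (simp add: R)
  then have "\<psi>' = Im s" using R by simp
  also have "Im s = (\<Sum>j\<in>UNIV. K j j / (1 + (d j)\<^sup>2))"
    unfolding s_def Im_sum
  proof (rule sum.cong[OF refl])
    fix j
    show "Im (complex_of_real (K j j) * ((of_real (d j) + \<i>) / of_real (1 + (d j)\<^sup>2))) = K j j / (1 + (d j)\<^sup>2)"
      unfolding Im_divide_of_real Re_divide_of_real by (simp del: of_real_add add: Im_divide_of_real)
  qed
  finally show ?thesis .
qed


section \<open>Differentiation along lines and symmetry of derivatives\<close>

lemma has_derivative_partial_derivs:
  fixes g :: "real^'n \<Rightarrow> real"
  assumes "g differentiable (at x)"
  shows "(g has_derivative (\<lambda>h. \<Sum>i\<in>UNIV. h $ i * partial_deriv i g x)) (at x)"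
proof -
  let ?D = "frechet_derivative g (at x)"
  have D: "(g has_derivative ?D) (at x)" using assms frechet_derivative_works by blast
  then have lin: "linear ?D" by (rule has_derivative_linear)
  have "?D h = (\<Sum>i\<in>UNIV. h $ i * partial_deriv i g x)" for h
  proof -
    have "?D h = ?D (\<Sum>i\<in>UNIV. h $ i *\<^sub>R axis i 1)"
      by (simp add: basis_expansion flip: scalar_mult_eq_scaleR)
    also have "\<dots> = (\<Sum>i\<in>UNIV. h $ i * partial_deriv i g x)"
      using lin by (simp add: linear_sum linear_cmul partial_deriv_def)
    finally show ?thesis .
  qed
  then show ?thesis using D by (metis (no_types, lifting) ext)
qed

lemma has_real_derivative_on_line:
  fixes g :: "real^'n \<Rightarrow> real"
  assumes "g differentiable (at (x + t *\<^sub>R b))"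
  shows "((\<lambda>s. g (x + s *\<^sub>R b)) has_real_derivative
     (\<Sum>i\<in>UNIV. b $ i * partial_deriv i g (x + t *\<^sub>R b))) (at t)"
proof -
  have 1: "((\<lambda>s. x + s *\<^sub>R b) has_derivative (\<lambda>s. s *\<^sub>R b)) (at t)"
    by (auto intro!: derivative_eq_intros)
  from has_derivative_compose[OF 1 has_derivative_partial_derivs[OF assms]]
  show ?thesis
    by (rule has_derivative_imp_has_field_derivative) (simp add: sum_distrib_left mult_ac)
qed

lemma partial_derivs_append: "partial_derivs (is @ js) g = partial_derivs is (partial_derivs js g)"
  by (induction "is") auto

lemma Ck_on_mono: "Ck_on k U g \<Longrightarrow> j \<le> k \<Longrightarrow> Ck_on j U g"
  unfolding Ck_on_def by (meson le_trans less_le_trans)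

lemma Ck_on_partial_deriv:
  assumes "Ck_on (Suc k) U g"
  shows "Ck_on k U (partial_deriv i g)"
proof -
  have "partial_derivs is (partial_deriv i g) = partial_derivs (is @ [i]) g" for "is"
    by (simp add: partial_derivs_append)
  then show ?thesis using assms unfolding Ck_on_def by simp
qed

lemma Ck_on_differentiable: "Ck_on k U g \<Longrightarrow> k > 0 \<Longrightarrow> x \<in> U \<Longrightarrow> g differentiable (at x)"
  unfolding Ck_on_def by (metis list.size(3) partial_derivs.simps(1))

lemma Ck_on_continuous: "Ck_on k U g \<Longrightarrow> continuous_on U g"
  unfolding Ck_on_def by (metis list.size(3) partial_derivs.simps(1) le0)

text \<open>Two applications of the mean value theorem, first in direction \<open>i\<close> and then in direction \<open>j\<close>.
The second difference is symmetric in \<open>i\<close> and \<open>j\<close>, which is what makes mixed derivatives agree.\<close>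

lemma second_difference_mvt:
  fixes g :: "real^'n \<Rightarrow> real"
  assumes C2: "Ck_on 2 U g" and U: "cball x (2 * h) \<subseteq> U" and h: "h > 0"
  obtains y where "norm (y - x) \<le> 2 * h"
    "g (x + h *\<^sub>R axis i 1 + h *\<^sub>R axis j 1) - g (x + h *\<^sub>R axis i 1) - g (x + h *\<^sub>R axis j 1) + g x
       = h * (h * partial_deriv j (partial_deriv i g) y)"
proof -
  let ?ei = "axis i (1::real)" and ?ej = "axis j (1::real)"
  have near: "x + s *\<^sub>R ?ei + t *\<^sub>R ?ej \<in> U" "norm (x + s *\<^sub>R ?ei + t *\<^sub>R ?ej - x) \<le> 2 * h"
    if "0 \<le> s" "s \<le> h" "0 \<le> t" "t \<le> h" for s t
  proof -
    have "norm (s *\<^sub>R ?ei + t *\<^sub>R ?ej) \<le> norm (s *\<^sub>R ?ei) + norm (t *\<^sub>R ?ej)" by (rule norm_triangle_ineq)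
    then have *: "norm (s *\<^sub>R ?ei + t *\<^sub>R ?ej) \<le> 2 * h" using that by simp
    then show "norm (x + s *\<^sub>R ?ei + t *\<^sub>R ?ej - x) \<le> 2 * h" by (simp add: algebra_simps)
    from * show "x + s *\<^sub>R ?ei + t *\<^sub>R ?ej \<in> U"
      using U by (auto simp: subset_iff dist_norm norm_minus_commute add.assoc)
  qed
  have line: "((\<lambda>s. G (y + s *\<^sub>R axis k 1)) has_real_derivative partial_deriv k G (y + s *\<^sub>R axis k 1)) (at s)"
    if "G differentiable (at (y + s *\<^sub>R axis k 1))" for G :: "real^'n \<Rightarrow> real" and y k s
    using has_real_derivative_on_line[OF that]
    by (simp add: axis_def if_distribR if_distrib cong: if_cong)
  have dg: "g differentiable (at y)" if "y \<in> U" for y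
    using Ck_on_differentiable[OF C2 _ that] by simp
  have dp: "partial_deriv i g differentiable (at y)" if "y \<in> U" for y
    using Ck_on_differentiable[OF Ck_on_partial_deriv[of 1] _ that] C2 by (simp add: numeral_2_eq_2)
  define \<phi> where "\<phi> s = g ((x + h *\<^sub>R ?ej) + s *\<^sub>R ?ei) - g (x + s *\<^sub>R ?ei)" for s
  have "\<exists>s. 0 < s \<and> s < h \<and> \<phi> h - \<phi> 0 = (h - 0) *
     (partial_deriv i g ((x + h *\<^sub>R ?ej) + s *\<^sub>R ?ei) - partial_deriv i g (x + s *\<^sub>R ?ei))"
  proof (rule MVT2[OF h])
    fix s assume s: "0 \<le> s" "s \<le> h"
    show "(\<phi> has_real_derivative
      (partial_deriv i g ((x + h *\<^sub>R ?ej) + s *\<^sub>R ?ei) - partial_deriv i g (x + s *\<^sub>R ?ei))) (at s)"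
      unfolding \<phi>_def
      by (intro DERIV_diff line dg) (use near[of s h] near[of s 0] s h in \<open>auto simp: algebra_simps\<close>)
  qed
  then obtain s where s: "0 < s" "s < h" and 1: "\<phi> h - \<phi> 0 = h *
     (partial_deriv i g ((x + h *\<^sub>R ?ej) + s *\<^sub>R ?ei) - partial_deriv i g (x + s *\<^sub>R ?ei))"
    by auto
  have "\<exists>t. 0 < t \<and> t < h \<and> partial_deriv i g ((x + s *\<^sub>R ?ei) + h *\<^sub>R ?ej) - partial_deriv i g ((x + s *\<^sub>R ?ei) + 0 *\<^sub>R ?ej)
     = (h - 0) * partial_deriv j (partial_deriv i g) ((x + s *\<^sub>R ?ei) + t *\<^sub>R ?ej)"
    by (rule MVT2[OF h], rule line, rule dp) (use near[of s] s in auto)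
  then obtain t where t: "0 < t" "t < h" and
     2: "partial_deriv i g ((x + s *\<^sub>R ?ei) + h *\<^sub>R ?ej) - partial_deriv i g (x + s *\<^sub>R ?ei)
     = h * partial_deriv j (partial_deriv i g) ((x + s *\<^sub>R ?ei) + t *\<^sub>R ?ej)"
    by auto
  show thesis
  proof (rule that)
    show "norm (((x + s *\<^sub>R ?ei) + t *\<^sub>R ?ej) - x) \<le> 2 * h" using near(2)[of s t] s t by simp
    have comm: "(x + h *\<^sub>R ?ej) + s *\<^sub>R ?ei = (x + s *\<^sub>R ?ei) + h *\<^sub>R ?ej"
      "(x + h *\<^sub>R ?ej) + h *\<^sub>R ?ei = (x + h *\<^sub>R ?ei) + h *\<^sub>R ?ej"
      by (simp_all add: algebra_simps)
    show "g (x + h *\<^sub>R ?ei + h *\<^sub>R ?ej) - g (x + h *\<^sub>R ?ei) - g (x + h *\<^sub>R ?ej) + g x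
       = h * (h * partial_deriv j (partial_deriv i g) ((x + s *\<^sub>R ?ei) + t *\<^sub>R ?ej))"
      using 1[unfolded \<phi>_def comm 2] by simp
  qed
qed

lemma partial_deriv_commute:
  fixes g :: "real^'n \<Rightarrow> real"
  assumes C2: "Ck_on 2 U g" and U: "open U" "x \<in> U"
  shows "partial_deriv i (partial_deriv j g) x = partial_deriv j (partial_deriv i g) x"
proof -
  have cont: "isCont (partial_deriv i (partial_deriv j g)) x" for i j
  proof -
    have "Ck_on 0 U (partial_deriv i (partial_deriv j g))"
      using C2 by (auto intro!: Ck_on_partial_deriv simp: numeral_2_eq_2)
    then show ?thesis using Ck_on_continuous U continuous_on_eq_continuous_at by blast
  qed
  let ?a = "partial_deriv i (partial_deriv j g)" and ?b = "partial_deriv j (partial_deriv i g)"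
  have "\<bar>?a x - ?b x\<bar> \<le> e" if "e > 0" for e
  proof -
    obtain r where r: "r > 0" "ball x r \<subseteq> U" using U open_contains_ball by blast
    obtain d1 where d1: "d1 > 0" "\<And>y. dist y x < d1 \<Longrightarrow> dist (?a y) (?a x) < e / 2"
      using cont[of i j] \<open>e > 0\<close> unfolding continuous_at_eps_delta by (meson half_gt_zero)
    obtain d2 where d2: "d2 > 0" "\<And>y. dist y x < d2 \<Longrightarrow> dist (?b y) (?b x) < e / 2"
      using cont[of j i] \<open>e > 0\<close> unfolding continuous_at_eps_delta by (meson half_gt_zero)
    define h where "h = min r (min d1 d2) / 4"
    have h: "h > 0" "2 * h < r" "2 * h < d1" "2 * h < d2"
      using r(1) d1(1) d2(1) by (auto simp: h_def min_def)
    then have cb: "cball x (2 * h) \<subseteq> U" using r by (auto simp: subset_iff)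
    obtain y where y: "norm (y - x) \<le> 2 * h" "g (x + h *\<^sub>R axis i 1 + h *\<^sub>R axis j 1) - g (x + h *\<^sub>R axis i 1) - g (x + h *\<^sub>R axis j 1) + g x = h * (h * ?b y)"
      using second_difference_mvt[OF C2 cb h(1)] .
    obtain z where z: "norm (z - x) \<le> 2 * h" "g (x + h *\<^sub>R axis j 1 + h *\<^sub>R axis i 1) - g (x + h *\<^sub>R axis j 1) - g (x + h *\<^sub>R axis i 1) + g x = h * (h * ?a z)"
      using second_difference_mvt[OF C2 cb h(1)] .
    have "h * (h * ?b y) = h * (h * ?a z)"
      using y(2) z(2) by (simp add: algebra_simps)
    then have "?b y = ?a z" using h(1) by simp
    moreover have "dist z x < d1" "dist y x < d2"
      using y(1) z(1) h by (auto simp: dist_norm)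
    then have "dist (?a z) (?a x) < e / 2" "dist (?b y) (?b x) < e / 2"
      by (auto dest: d1(2) d2(2) simp del: dist_real_def)
    ultimately show ?thesis unfolding dist_real_def by linarith
  qed
  then have "\<bar>?a x - ?b x\<bar> \<le> 0" by (rule field_le_epsilon) simp
  then show ?thesis by simp
qed

text \<open>If \<open>D > 0\<close>, then \<open>q'\<close> is positive just to the right of its zero \<open>0\<close>, so \<open>q\<close> increases there.\<close>

lemma second_derivative_at_local_max:
  fixes q :: "real \<Rightarrow> real"
  assumes q: "\<And>t. \<bar>t\<bar> < \<delta> \<Longrightarrow> (q has_real_derivative q' t) (at t)"
    and q': "(q' has_real_derivative D) (at 0)"
    and \<delta>: "\<delta> > 0" and max: "\<And>t. \<bar>t\<bar> < \<delta> \<Longrightarrow> q t \<le> q 0"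
  shows "q' 0 = 0" "D \<le> 0"
proof -
  show 0: "q' 0 = 0"
    using DERIV_local_max[OF q[of 0] \<delta>] max \<delta> by simp
  show "D \<le> 0"
  proof (rule ccontr)
    assume "\<not> D \<le> 0"
    then obtain e where e: "e > 0" "\<And>h. 0 < h \<Longrightarrow> h < e \<Longrightarrow> q' 0 < q' h"
      using DERIV_pos_inc_right[OF q'] by auto
    define s where "s = min e \<delta> / 2"
    have s: "0 < s" "s < e" "s < \<delta>" using e \<delta> by (auto simp: s_def min_def)
    obtain t where t: "0 < t" "t < s" "q s - q 0 = (s - 0) * q' t"
      using MVT2[OF s(1), of q q'] q s by force
    have "q' t > 0" using e(2)[of t] t s 0 by simp
    then have "q s > q 0" using t(3) s(1) by (simp add: algebra_simps)
    with max[of s] s show False by simp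
  qed
qed


definition third_derivative :: "(real^'n \<Rightarrow> real) \<Rightarrow> real^'n \<Rightarrow> real^'n \<Rightarrow> real^'n \<Rightarrow> real^'n \<Rightarrow> real" where
  "third_derivative u a b c x = (\<Sum>i\<in>UNIV. \<Sum>j\<in>UNIV. \<Sum>k\<in>UNIV.
     a $ i * (b $ j * (c $ k * partial_deriv i (partial_deriv j (partial_deriv k u)) x)))"

lemma inner_hessian:
  "b \<bullet> (hessian u x *v c) = (\<Sum>j\<in>UNIV. \<Sum>k\<in>UNIV. b $ j * (c $ k * partial_deriv j (partial_deriv k u) x))"
  by (simp add: inner_vec_def matrix_vector_mult_def hessian_def sum_distrib_left mult_ac)

lemma line_derivative:
  fixes g :: "real^'n \<Rightarrow> real"
  assumes "Ck_on 1 U g" "x + t *\<^sub>R b \<in> U"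
  shows "((\<lambda>s. g (x + s *\<^sub>R b)) has_real_derivative grad g (x + t *\<^sub>R b) \<bullet> b) (at t)"
  using has_real_derivative_on_line[OF Ck_on_differentiable[OF assms(1) _ assms(2)]]
  by (simp add: grad_def inner_vec_def mult.commute)

lemma line_derivative_grad:
  assumes "Ck_on 2 U u" "x + t *\<^sub>R b \<in> U"
  shows "((\<lambda>s. grad u (x + s *\<^sub>R b) \<bullet> c) has_real_derivative b \<bullet> (hessian u (x + t *\<^sub>R b) *v c)) (at t)"
proof -
  have "((\<lambda>s. \<Sum>k\<in>UNIV. partial_deriv k u (x + s *\<^sub>R b) * c $ k) has_real_derivative
     (\<Sum>k\<in>UNIV. (\<Sum>j\<in>UNIV. b $ j * partial_deriv j (partial_deriv k u) (x + t *\<^sub>R b)) * c $ k)) (at t)"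
    using assms
    by (intro DERIV_sum DERIV_cmult_right has_real_derivative_on_line
        Ck_on_differentiable[OF Ck_on_partial_deriv[of 1]]) (auto simp: numeral_2_eq_2)
  also have "(\<Sum>k\<in>UNIV. (\<Sum>j\<in>UNIV. b $ j * partial_deriv j (partial_deriv k u) (x + t *\<^sub>R b)) * c $ k)
     = b \<bullet> (hessian u (x + t *\<^sub>R b) *v c)"
    unfolding inner_hessian sum_distrib_right by (subst sum.swap) (simp add: mult_ac)
  finally show ?thesis by (simp add: grad_def inner_vec_def)
qed

lemma line_derivative_hessian:
  assumes "Ck_on 3 U u" "x + t *\<^sub>R a \<in> U"
  shows "((\<lambda>s. b \<bullet> (hessian u (x + s *\<^sub>R a) *v c)) has_real_derivative third_derivative u a b c (x + t *\<^sub>R a)) (at t)"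
proof -
  have "((\<lambda>s. b \<bullet> (hessian u (x + s *\<^sub>R a) *v c)) has_real_derivative
     (\<Sum>j\<in>UNIV. \<Sum>k\<in>UNIV. b $ j * (c $ k *
       (\<Sum>i\<in>UNIV. a $ i * partial_deriv i (partial_deriv j (partial_deriv k u)) (x + t *\<^sub>R a))))) (at t)"
    unfolding inner_hessian using assms
    by (intro DERIV_sum DERIV_cmult has_real_derivative_on_line
        Ck_on_differentiable[OF Ck_on_partial_deriv[OF Ck_on_partial_deriv[of "Suc (Suc 0)"]]])
      (auto simp: numeral_3_eq_3)
  also have "(\<Sum>j\<in>UNIV. \<Sum>k\<in>UNIV. b $ j * (c $ k *
       (\<Sum>i\<in>UNIV. a $ i * partial_deriv i (partial_deriv j (partial_deriv k u)) (x + t *\<^sub>R a))))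
     = (\<Sum>j\<in>UNIV. \<Sum>k\<in>UNIV. \<Sum>i\<in>UNIV. 
     a $ i * (b $ j * (c $ k * partial_deriv i (partial_deriv j (partial_deriv k u)) (x + t *\<^sub>R a))))"
    by (simp add: sum_distrib_left mult_ac)
  also have "\<dots> = (\<Sum>j\<in>UNIV. \<Sum>i\<in>UNIV. \<Sum>k\<in>UNIV. 
     a $ i * (b $ j * (c $ k * partial_deriv i (partial_deriv j (partial_deriv k u)) (x + t *\<^sub>R a))))"
    by (intro sum.cong refl sum.swap)
  also have "\<dots> = third_derivative u a b c (x + t *\<^sub>R a)"
    unfolding third_derivative_def by (rule sum.swap)
  finally show ?thesis .
qed

lemma hessian_symmetric:
  assumes "Ck_on 2 U u" "open U" "x \<in> U"
  shows "transpose (hessian u x) = hessian u x"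
  using partial_deriv_commute[OF assms] by (simp add: transpose_def hessian_def)

text \<open>This turns the derivative of the Hessian in the direction \<open>e\<close>, which appears in the differentiated
equation, into the second derivative of \<open>\<langle>Du, e\<rangle>\<close>, which appears in the maximum principle.\<close>

lemma third_derivative_swap:
  assumes "Ck_on 3 U u" "open U" "x \<in> U"
  shows "third_derivative u e b b x = third_derivative u b b e x"
proof -
  have 1: "partial_deriv i (partial_deriv j (partial_deriv k u)) x
     = partial_deriv j (partial_deriv i (partial_deriv k u)) x" for i j k
    by (rule partial_deriv_commute[OF Ck_on_partial_deriv assms(2,3)]) (use assms in \<open>simp add: numeral_eq_Suc\<close>)
  have eq: "partial_deriv j (partial_deriv k u) y = partial_deriv k (partial_deriv j u) y" if "y \<in> U" for j k y
    by (rule partial_deriv_commute[OF Ck_on_mono[OF assms(1)] assms(2) that]) simp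
  have 2: "partial_deriv i (partial_deriv j (partial_deriv k u)) x
     = partial_deriv i (partial_deriv k (partial_deriv j u)) x" for i j k
  proof -
    have "partial_deriv j (partial_deriv k u) differentiable (at x)"
      by (rule Ck_on_differentiable[OF Ck_on_partial_deriv[OF Ck_on_partial_deriv] _ assms(3), of "Suc 0"])
        (use assms(1) in \<open>simp_all add: numeral_3_eq_3\<close>)
    then have "(partial_deriv j (partial_deriv k u) has_derivative
        frechet_derivative (partial_deriv j (partial_deriv k u)) (at x)) (at x)"
      by (simp add: frechet_derivative_works)
    then have "(partial_deriv k (partial_deriv j u) has_derivative
        frechet_derivative (partial_deriv j (partial_deriv k u)) (at x)) (at x)"
      by (rule has_derivative_transform_within_open[OF _ assms(2,3) eq])
    then have "frechet_derivative (partial_deriv j (partial_deriv k u)) (at x)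
        = frechet_derivative (partial_deriv k (partial_deriv j u)) (at x)"
      by (rule frechet_derivative_at)
    then show ?thesis by (simp add: partial_deriv_def[of i])
  qed
  have "third_derivative u e b b x = (\<Sum>i\<in>UNIV. \<Sum>j\<in>UNIV. \<Sum>k\<in>UNIV.
     b $ j * (b $ k * (e $ i * partial_deriv j (partial_deriv k (partial_deriv i u)) x)))"
    unfolding third_derivative_def by (intro sum.cong refl) (metis (no_types, opaque_lifting) 1 2 mult.left_commute)
  also have "\<dots> = (\<Sum>j\<in>UNIV. \<Sum>i\<in>UNIV. \<Sum>k\<in>UNIV.
     b $ j * (b $ k * (e $ i * partial_deriv j (partial_deriv k (partial_deriv i u)) x)))"
    by (rule sum.swap)
  also have "\<dots> = third_derivative u b b e x"
    unfolding third_derivative_def by (intro sum.cong refl sum.swap)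
  finally show ?thesis .
qed

lemma linearized_equation:
  fixes u \<phi> :: "real^'n \<Rightarrow> real"
  assumes C3: "Ck_on 3 U u" and U: "open U" "x \<in> U" and d\<phi>: "\<phi> differentiable (at x)"
    and eq: "\<And>y. y \<in> U \<Longrightarrow> (\<Sum>l\<in>#eigenvalues (hessian u y). arctan l) = \<phi> y + c"
    and P: "orthogonal_matrix P" "\<And>i. hessian u x *v column i P = d i *\<^sub>R column i P"
  shows "grad \<phi> x \<bullet> e = (\<Sum>i\<in>UNIV. third_derivative u (column i P) (column i P) e x / (1 + (d i)\<^sup>2))"
proof -
  have "grad \<phi> x \<bullet> e = (\<Sum>i\<in>UNIV. third_derivative u e (column i P) (column i P) x / (1 + (d i)\<^sup>2))"
  proof (rule phase_derivative[where H = "\<lambda>t. hessian u (x + t *\<^sub>R e)" and \<psi> = "\<lambda>t. \<phi> (x + t *\<^sub>R e) + c" and P = P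
        and K = "\<lambda>i j. third_derivative u e (column i P) (column j P) x"])
    have "open ((\<lambda>t. x + t *\<^sub>R e) -` U)"
      by (intro continuous_open_vimage continuous_intros U)
    then have "eventually (\<lambda>t. x + t *\<^sub>R e \<in> U) (nhds 0)"
      using U(2) by (auto simp: eventually_nhds intro!: exI[of _ "(\<lambda>t. x + t *\<^sub>R e) -` U"])
    then show "eventually (\<lambda>t. transpose (hessian u (x + t *\<^sub>R e)) = hessian u (x + t *\<^sub>R e) \<and>
       (\<Sum>l\<in>#eigenvalues (hessian u (x + t *\<^sub>R e)). arctan l) = \<phi> (x + t *\<^sub>R e) + c) (nhds 0)"
      by (rule eventually_mono) (use eq hessian_symmetric[OF Ck_on_mono[OF C3] U(1)] in auto)
    show "((\<lambda>t. column i P \<bullet> (hessian u (x + t *\<^sub>R e) *v column j P)) has_real_derivative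
       third_derivative u e (column i P) (column j P) x) (at 0)" for i j
      using line_derivative_hessian[OF C3, of x 0 e] U by simp
    have "((\<lambda>t. \<phi> (x + t *\<^sub>R e)) has_real_derivative grad \<phi> x \<bullet> e) (at 0)"
      using has_real_derivative_on_line[of \<phi> x 0 e] d\<phi> by (simp add: grad_def inner_vec_def mult.commute)
    then show "((\<lambda>t. \<phi> (x + t *\<^sub>R e) + c) has_real_derivative grad \<phi> x \<bullet> e) (at 0)"
      by (auto intro!: derivative_eq_intros)
    show "orthogonal_matrix P" by fact
    show "hessian u (x + 0 *\<^sub>R e) *v column i P = d i *\<^sub>R column i P" for i using P by simp
  qed
  moreover have "third_derivative u e (column i P) (column i P) x = third_derivative u (column i P) (column i P) e x" for i
    by (rule third_derivative_swap[OF C3 U])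
  ultimately show ?thesis by simp
qed



section \<open>The inequality at a critical point\<close>

text \<open>Each of the other \<open>n - 2\<close> summands is below \<open>\<pi>/2\<close>, so \<open>arctan \<lambda>\<^sub>j + arctan \<lambda>\<^sub>k \<ge> 0\<close>.\<close>

lemma phase_forces_large_eigenvalues:
  fixes lam :: "'n::finite \<Rightarrow> real"
  assumes "(\<Sum>i\<in>UNIV. arctan (lam i)) \<ge> (real CARD('n) - 2) * (pi / 2)" "j \<noteq> k"
  shows "- lam k \<le> lam j"
proof -
  have "(\<Sum>i\<in>UNIV. arctan (lam i)) = (\<Sum>i\<in>{j,k}. arctan (lam i)) + (\<Sum>i\<in>UNIV-{j,k}. arctan (lam i))"
    by (rule sum.subset_diff[THEN trans, OF _ _ add.commute]) auto
  also have "(\<Sum>i\<in>UNIV-{j,k}. arctan (lam i)) \<le> (\<Sum>i\<in>UNIV-{j,k}. pi / 2)"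
    by (intro sum_mono less_imp_le arctan_ubound)
  also have "\<dots> = (real CARD('n) - 2) * (pi / 2)"
  proof -
    have "card {j, k} \<le> CARD('n)" by (rule card_mono) auto
    then show ?thesis using \<open>j \<noteq> k\<close> by (simp add: card_Diff_subset of_nat_diff)
  qed
  finally have "arctan (- lam k) \<le> arctan (lam j)"
    using assms by (simp add: arctan_minus)
  then show ?thesis by (simp add: arctan_le_iff)
qed

text \<open>With one eigenvalue equal to \<open>-\<mu> < 0\<close>, the sum is at most \<open>(n - 1) \<pi>/2 - arctan \<mu>\<close>, and
\<open>\<pi>/2 - arctan \<mu> = arctan (1/\<mu>) \<le> 1/\<mu>\<close>.\<close>

lemma phase_excess_le:
  fixes lam :: "'n::finite \<Rightarrow> real"
  assumes "lam k < 0"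
  shows "(\<Sum>i\<in>UNIV. arctan (lam i)) - (real CARD('n) - 2) * (pi / 2) \<le> 1 / (- lam k)"
proof -
  have "(\<Sum>i\<in>UNIV. arctan (lam i)) = arctan (lam k) + (\<Sum>i\<in>UNIV-{k}. arctan (lam i))"
    by (rule sum.remove) auto
  also have "(\<Sum>i\<in>UNIV-{k}. arctan (lam i)) \<le> (\<Sum>i\<in>UNIV-{k}. pi / 2)"
    by (intro sum_mono less_imp_le arctan_ubound)
  also have "\<dots> = (real CARD('n) - 1) * (pi / 2)"
    by (simp add: card_Diff_subset of_nat_diff Suc_leI)
  finally have "(\<Sum>i\<in>UNIV. arctan (lam i)) - (real CARD('n) - 2) * (pi / 2) \<le> pi / 2 - arctan (- lam k)"
    by (simp add: arctan_minus field_simps)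
  also have "\<dots> = arctan (1 / (- lam k))"
    using arctan_inverse[of "- lam k"] assms by (simp add: inverse_eq_divide)
  also have "\<dots> \<le> 1 / (- lam k)"
    using arctan_le_self[of "1 / (- lam k)"] assms by simp
  finally show ?thesis .
qed

text \<open>The purely numerical part of the argument. In the application \<open>e\<close>, \<open>x\<close> and \<open>lam\<close> are the coordinates
of the gradient direction, the coordinates of the maximum point and the Hessian eigenvalues in an
eigenbasis; \<open>p\<close> is \<open>|Du|\<close>, \<open>b\<close> is \<open>A (u - inf u + 1)\<close>, \<open>D\<close> is \<open>|D\<phi>|\<close>, and \<open>first\<close> and \<open>second\<close> are the
first and second order conditions. The choice \<open>A = 2n + 1\<close> makes \<open>b p\<close> exceed by at least \<open>p\<close> the
error \<open>2 n p\<close> with which the first order condition determines \<open>- \<eta> \<lambda>\<^sub>k\<close>. The constant \<open>C1\<close> bounds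
\<open>|\<lambda>\<^sub>k| \<eta>/p\<close>, and \<open>C2\<close> collects the coefficients of the error terms of order \<open>p/\<eta>\<close>.\<close>

lemma critical_point_inequality:
  fixes lam e x :: "'n::finite \<Rightarrow> real" and \<eta> p b B D \<phi> :: real
  defines "n \<equiv> real CARD('n)"
  defines "A \<equiv> 2 * n + 1" and "C1 \<equiv> B + 2 * n"
  defines "C2 \<equiv> n * (2 + 4 * (2 + B)) + B * C1"
  assumes e: "(\<Sum>i\<in>UNIV. (e i)\<^sup>2) = 1" and x: "\<And>i. \<bar>x i\<bar> \<le> 1"
    and eta: "0 < \<eta>" "\<eta> \<le> 1" and p: "p > 0" and b: "A \<le> b" "b \<le> B"
    and first: "\<And>i. \<eta> * lam i * e i = 2 * x i * p - b * p * e i"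
    and phase: "\<phi> = (\<Sum>i\<in>UNIV. arctan (lam i)) - (n - 2) * (pi / 2)" "\<phi> \<ge> 0"
    and second: "(\<Sum>i\<in>UNIV. (A * p\<^sup>2 * (e i)\<^sup>2 + b * lam i - 4 * x i * lam i * e i - 2 * p) / (1 + (lam i)\<^sup>2)) \<le> \<eta> * D"
    and large: "1 \<le> \<eta> * p" "2 * n * C2 \<le> A * (\<eta> * p)"
  shows "\<phi> / \<eta>\<^sup>2 \<le> 1 / (\<eta> * p)" "A * \<eta> / (4 * n * C1\<^sup>2) \<le> D"
proof -
  have n: "n \<ge> 1" by (simp add: n_def Suc_leI)
  have A: "A > 0" and B: "B \<ge> 1" using n b by (auto simp: A_def)
  have C1: "C1 > 0" using n B by (auto simp: C1_def)
  \<comment> \<open>A direction carrying a definite share of the gradient.\<close>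
  have "\<exists>k. (e k)\<^sup>2 \<ge> 1 / n"
  proof (rule ccontr)
    assume "\<not> ?thesis"
    then have "(\<Sum>i\<in>UNIV. (e i)\<^sup>2) < (\<Sum>i\<in>(UNIV :: 'n set). 1 / n)"
      by (intro sum_strict_mono) (auto simp: not_le)
    also have "\<dots> = 1" by (simp add: n_def)
    finally show False using e by simp
  qed
  then obtain k where k: "(e k)\<^sup>2 \<ge> 1 / n" by blast
  have ek: "\<bar>e k\<bar> \<ge> 1 / n"
  proof (rule power2_le_imp_le)
    have "(1 / n)\<^sup>2 \<le> 1 / n" using n by (simp add: power2_eq_square divide_simps)
    then show "(1 / n)\<^sup>2 \<le> \<bar>e k\<bar>\<^sup>2" using k by simp
  qed simp
  define \<mu> where "\<mu> = - lam k"
  have "(\<eta> * lam k + b * p) * e k = 2 * x k * p" using first[of k] by (simp add: algebra_simps)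
  then have "\<bar>\<eta> * lam k + b * p\<bar> * \<bar>e k\<bar> = 2 * \<bar>x k\<bar> * p"
    using p by (metis abs_mult abs_numeral abs_of_pos)
  also have "\<dots> \<le> 2 * p" using x[of k] p by simp
  finally have "\<bar>\<eta> * lam k + b * p\<bar> * (1 / n) \<le> 2 * p"
    using mult_left_mono[OF ek, of "\<bar>\<eta> * lam k + b * p\<bar>"] by linarith
  then have close: "\<bar>\<eta> * lam k + b * p\<bar> \<le> 2 * n * p" using n by (simp add: field_simps)
  have "A * p \<le> b * p" "b * p \<le> B * p" using b p by simp_all
  with close have "p \<le> \<eta> * \<mu>" "\<eta> * \<mu> \<le> C1 * p"
    by (auto simp: \<mu>_def A_def C1_def algebra_simps)
  then have mu: "p / \<eta> \<le> \<mu>" "\<mu> \<le> C1 * p / \<eta>" using eta by (auto simp: field_simps)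
  have peta: "p \<le> p / \<eta>" "1 \<le> p"
  proof -
    show "p \<le> p / \<eta>" using eta p by (simp add: field_simps)
    show "1 \<le> p" using large(1) mult_right_mono[OF eta(2), of p] p by linarith
  qed
  have mu1: "\<mu> \<ge> 1" using mu peta by linarith
  have others: "\<mu> \<le> lam j" if "j \<noteq> k" for j
    unfolding \<mu>_def by (rule phase_forces_large_eigenvalues) (use phase that in \<open>auto simp: n_def\<close>)
  have "\<phi> \<le> 1 / \<mu>"
    using phase_excess_le[of lam k] phase(1) mu1 by (simp add: \<mu>_def n_def)
  also have "\<dots> \<le> \<eta> / p" using mu(1) eta p mu1 by (simp add: field_simps)
  finally have "\<phi> \<le> \<eta> / p" .
  then have "\<phi> / \<eta>\<^sup>2 \<le> (\<eta> / p) / \<eta>\<^sup>2" by (rule divide_right_mono) simp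
  also have "\<dots> = 1 / (\<eta> * p)" using eta by (simp add: power2_eq_square)
  finally show "\<phi> / \<eta>\<^sup>2 \<le> 1 / (\<eta> * p)" .
  \<comment> \<open>The coefficient \<open>g k\<close> of the negative direction dominates, since \<open>|lam i| \<ge> \<mu>\<close> for all \<open>i\<close>.\<close>
  define g where "g i = 1 / (1 + (lam i)\<^sup>2)" for i
  have g0: "g i > 0" for i by (simp add: g_def add_pos_nonneg)
  have gk: "g i \<le> g k" for i
  proof (cases "i = k")
    case False
    then have "\<mu>\<^sup>2 \<le> (lam i)\<^sup>2" using others[of i] mu1 by (intro power_mono) auto
    then show ?thesis by (auto simp: g_def \<mu>_def intro!: divide_left_mono mult_pos_pos add_pos_nonneg)
  qed simp
  define E where "E = (2 + 4 * (2 + B)) * p / \<eta>"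
  have E: "4 * x i * lam i * e i + 2 * p \<le> E" for i
  proof -
    have e1: "\<bar>e i\<bar> \<le> 1"
    proof -
      have "(e i)\<^sup>2 \<le> (\<Sum>i\<in>UNIV. (e i)\<^sup>2)" by (rule member_le_sum) auto
      then show ?thesis using e by (simp add: abs_square_le_1)
    qed
    have "\<eta> * \<bar>lam i * e i\<bar> = \<bar>\<eta> * lam i * e i\<bar>"
      using eta by (simp add: abs_mult)
    also have "\<dots> = \<bar>2 * x i * p - b * p * e i\<bar>" by (simp add: first)
    also have "\<dots> \<le> \<bar>2 * x i * p\<bar> + \<bar>b * p * e i\<bar>" by (rule abs_triangle_ineq4)
    also have "\<dots> \<le> 2 * p + B * p"
    proof (rule add_mono)
      show "\<bar>2 * x i * p\<bar> \<le> 2 * p" using x[of i] p by (simp add: abs_mult)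
      have "\<bar>b * p * e i\<bar> = (b * p) * \<bar>e i\<bar>" using p b A by (simp add: abs_mult)
      also have "\<dots> \<le> (b * p) * 1" using p b A e1 by (intro mult_left_mono) auto
      also have "\<dots> \<le> B * p" using b p by simp
      finally show "\<bar>b * p * e i\<bar> \<le> B * p" .
    qed
    finally have l: "\<bar>lam i * e i\<bar> \<le> (2 + B) * p / \<eta>" using eta by (simp add: field_simps)
    have "4 * x i * lam i * e i \<le> \<bar>4 * x i * (lam i * e i)\<bar>" by simp
    also have "\<dots> = 4 * (\<bar>x i\<bar> * \<bar>lam i * e i\<bar>)" by (simp add: abs_mult)
    also have "\<dots> \<le> 4 * (1 * ((2 + B) * p / \<eta>))"
      using x[of i] l by (intro mult_left_mono mult_mono) auto
    finally have "4 * x i * lam i * e i \<le> 4 * ((2 + B) * p / \<eta>)" by simp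
    moreover have "E = 2 * (p / \<eta>) + 4 * ((2 + B) * p / \<eta>)"
      by (simp add: E_def algebra_simps add_divide_distrib)
    ultimately show ?thesis using peta(1) by linarith
  qed
  have "g k * (A * p\<^sup>2 / n) - B * C1 * (p / \<eta>) * g k - n * (g k * E)
     \<le> (\<Sum>i\<in>UNIV. g i * (A * p\<^sup>2 * (e i)\<^sup>2)) + (\<Sum>i\<in>UNIV. g i * (b * lam i)) - (\<Sum>i\<in>(UNIV :: 'n set). g k * E)"
  proof (intro diff_mono add_mono[where b = "sum _ _" and c = "- (B * C1 * (p / \<eta>) * g k)", simplified add_uminus_conv_diff])
    have "g k * (A * p\<^sup>2 / n) = g k * (A * p\<^sup>2 * (1 / n))" by simp
    also have "\<dots> \<le> g k * (A * p\<^sup>2 * (e k)\<^sup>2)"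
      using k A g0[of k] by (intro mult_left_mono) auto
    also have "\<dots> \<le> (\<Sum>i\<in>UNIV. g i * (A * p\<^sup>2 * (e i)\<^sup>2))"
      by (rule member_le_sum) (use A less_imp_le[OF g0] in auto)
    finally show "g k * (A * p\<^sup>2 / n) \<le> (\<Sum>i\<in>UNIV. g i * (A * p\<^sup>2 * (e i)\<^sup>2))" .
    have "b * \<mu> \<le> B * (C1 * p / \<eta>)" using b mu mu1 B by (intro mult_mono) auto
    then have "- (B * C1 * (p / \<eta>) * g k) \<le> g k * (b * lam k)"
      using mult_left_mono[OF _ less_imp_le[OF g0[of k]], of "b * \<mu>" "B * (C1 * p / \<eta>)"]
      by (simp add: \<mu>_def algebra_simps)
    also have "\<dots> \<le> g k * (b * lam k) + (\<Sum>i\<in>UNIV-{k}. g i * (b * lam i))"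
    proof -
      have "0 \<le> g i * (b * lam i)" if "i \<noteq> k" for i
        using g0[of i] others[OF that] mu1 b A by simp
      then have "0 \<le> (\<Sum>i\<in>UNIV-{k}. g i * (b * lam i))" by (intro sum_nonneg) auto
      then show ?thesis by simp
    qed
    also have "\<dots> = (\<Sum>i\<in>UNIV. g i * (b * lam i))"
      by (rule sum.remove[symmetric]) auto
    finally show "- (B * C1 * (p / \<eta>) * g k) \<le> (\<Sum>i\<in>UNIV. g i * (b * lam i))" .
    show "(\<Sum>i\<in>(UNIV :: 'n set). g k * E) \<le> n * (g k * E)" by (simp add: n_def)
  qed
  also have "\<dots> = (\<Sum>i\<in>UNIV. g i * (A * p\<^sup>2 * (e i)\<^sup>2) + g i * (b * lam i) - g k * E)"
    by (simp add: sum.distrib sum_subtractf)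
  also have "\<dots> \<le> (\<Sum>i\<in>UNIV. (A * p\<^sup>2 * (e i)\<^sup>2 + b * lam i - 4 * x i * lam i * e i - 2 * p) / (1 + (lam i)\<^sup>2))"
  proof (rule sum_mono)
    fix i
    have "E \<ge> 0" using p eta B by (simp add: E_def)
    have "g i * (4 * x i * lam i * e i + 2 * p) \<le> g i * E" using E g0[of i] by simp
    also have "\<dots> \<le> g k * E" using gk \<open>E \<ge> 0\<close> by (rule mult_right_mono)
    finally have "g i * (A * p\<^sup>2 * (e i)\<^sup>2) + g i * (b * lam i) - g k * E
       \<le> g i * (A * p\<^sup>2 * (e i)\<^sup>2 + b * lam i - 4 * x i * lam i * e i - 2 * p)"
      by (simp add: algebra_simps)
    then show "g i * (A * p\<^sup>2 * (e i)\<^sup>2) + g i * (b * lam i) - g k * E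
       \<le> (A * p\<^sup>2 * (e i)\<^sup>2 + b * lam i - 4 * x i * lam i * e i - 2 * p) / (1 + (lam i)\<^sup>2)"
      by (simp add: g_def)
  qed
  also have "\<dots> \<le> \<eta> * D" by (rule second)
  finally have main: "g k * (A * p\<^sup>2 / n - C2 * (p / \<eta>)) \<le> \<eta> * D"
    by (simp add: E_def C2_def algebra_simps add_divide_distrib)
  have "C2 * (p / \<eta>) \<le> A * p\<^sup>2 / (2 * n)"
  proof -
    have "(2 * n * C2) * (p / \<eta>) \<le> (A * (\<eta> * p)) * (p / \<eta>)"
      using large(2) p eta by (intro mult_right_mono) auto
    also have "\<dots> = A * p\<^sup>2" using eta by (simp add: power2_eq_square)
    finally show ?thesis using n by (simp add: field_simps)
  qed
  then have "A * p\<^sup>2 / (2 * n) \<le> A * p\<^sup>2 / n - C2 * (p / \<eta>)" using n by (simp add: field_simps)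
  then have "g k * (A * p\<^sup>2 / (2 * n)) \<le> \<eta> * D"
    using main mult_left_mono[OF _ less_imp_le[OF g0[of k]]] by (meson order_trans)
  moreover have "\<eta>\<^sup>2 / (2 * C1\<^sup>2) \<le> g k * p\<^sup>2"
  proof -
    have "1 + (lam k)\<^sup>2 \<le> 2 * \<mu>\<^sup>2" using mu1 by (simp add: \<mu>_def one_le_power[of "- lam k" 2, simplified])
    also have "\<dots> \<le> 2 * (C1 * p / \<eta>)\<^sup>2" using mu mu1 by (intro mult_left_mono power_mono) auto
    finally have "1 / (2 * (C1 * p / \<eta>)\<^sup>2) \<le> g k"
      unfolding g_def by (intro divide_left_mono) (use C1 p eta in \<open>auto simp: add_pos_nonneg\<close>)
    then have "1 / (2 * (C1 * p / \<eta>)\<^sup>2) * p\<^sup>2 \<le> g k * p\<^sup>2" by (rule mult_right_mono) simp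
    then show ?thesis using p eta C1 by (simp add: power_divide power_mult_distrib)
  qed
  then have "\<eta>\<^sup>2 / (2 * C1\<^sup>2) * (A / (2 * n)) \<le> g k * p\<^sup>2 * (A / (2 * n))"
    using A n by (intro mult_right_mono) auto
  ultimately have "\<eta> * (A * \<eta> / (4 * n * C1\<^sup>2)) \<le> \<eta> * D"
    by (simp add: power2_eq_square mult_ac)
  then show "A * \<eta> / (4 * n * C1\<^sup>2) \<le> D"
    by (rule mult_left_le_imp_le[OF _ eta(1)])
qed


section \<open>The maximum principle\<close>

lemma eta_line_derivative:
  "((\<lambda>s. eta (x + s *\<^sub>R b)) has_real_derivative - 2 * ((x + t *\<^sub>R b) \<bullet> b)) (at t)"
proof -
  have expand: "eta (x + s *\<^sub>R b) = 1 - (x \<bullet> x + 2 * s * (x \<bullet> b) + s\<^sup>2 * (b \<bullet> b))" for s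
    unfolding eta_def power2_norm_eq_inner inner_add_left inner_add_right inner_scaleR_left inner_scaleR_right
      inner_commute[of b x] by (simp add: power2_eq_square distrib_left)
  show ?thesis
    unfolding expand inner_add_left inner_scaleR_left by (auto intro!: derivative_eq_intros)
qed

lemma sum_inner_columns_squared:
  fixes P :: "real^'n^'n"
  assumes "orthogonal_matrix P"
  shows "(\<Sum>i\<in>UNIV. (column i P \<bullet> e)\<^sup>2) = (norm e)\<^sup>2"
proof -
  have "norm (transpose P *v e) = norm e"
    using assms by (intro orthogonal_transformation_norm) (simp add: orthogonal_transformation_matrix del: transpose_matrix_vector)
  moreover have "(norm (transpose P *v e))\<^sup>2 = (\<Sum>i\<in>UNIV. (column i P \<bullet> e)\<^sup>2)"
    unfolding power2_norm_eq_inner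
    by (simp add: inner_vec_def matrix_vector_mult_def transpose_def column_def power2_eq_square)
  ultimately show ?thesis by simp
qed

text \<open>Besides freezing \<open>e\<close>, the proof uses that along each \<open>b i\<close> the barrier function
\<open>\<eta> \<langle>Du, e\<rangle> + A/2 w\<^sup>2\<close> has first derivative zero and nonpositive second derivative at \<open>x\<close>; in the
eigenbasis these are exactly the two conditions of \<open>critical_point_inequality\<close>.\<close>

lemma interior_maximum_estimate:
  fixes u \<phi> :: "real^'n \<Rightarrow> real" and m W :: real
  defines "n \<equiv> real CARD('n)"
  defines "A \<equiv> 2 * n + 1"
  defines "B \<equiv> A * (1 + W)"
  defines "C1 \<equiv> B + 2 * n"
  defines "C2 \<equiv> n * (2 + 4 * (2 + B)) + B * C1"
  defines "Q \<equiv> \<lambda>x. eta x * norm (grad u x) + A / 2 * (u x - m + 1)\<^sup>2"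
  assumes C3: "Ck_on 3 (ball 0 1) u" and x: "x \<in> ball 0 1" and d\<phi>: "\<phi> differentiable (at x)"
    and eq: "\<And>y. y \<in> ball 0 1 \<Longrightarrow> (\<Sum>l\<in>#eigenvalues (hessian u y). arctan l) = \<phi> y + (n - 2) * (pi / 2)"
    and \<phi>: "\<phi> x \<ge> 0" and u: "m \<le> u x" "u x \<le> m + W"
    and max: "\<And>y. y \<in> ball 0 1 \<Longrightarrow> Q y \<le> Q x"
    and large: "1 \<le> eta x * norm (grad u x)" "2 * n * C2 \<le> A * (eta x * norm (grad u x))"
  shows "\<phi> x / (eta x)\<^sup>2 \<le> 1 / (eta x * norm (grad u x))"
    "A * eta x / (4 * n * C1\<^sup>2) \<le> norm (grad \<phi> x)"
proof -
  have C2: "Ck_on 2 (ball 0 1) u" and C1': "Ck_on 1 (ball 0 1) u"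
    using Ck_on_mono[OF C3] by auto
  have eta_pos: "eta y > 0" if "y \<in> ball 0 1" for y :: "real^'n"
    using that by (simp add: eta_def abs_square_less_1)
  have eta: "0 < eta x" "eta x \<le> 1" using eta_pos[OF x] by (auto simp: eta_def)
  define p where "p = norm (grad u x)"
  have p: "p > 0" using large(1) eta by (auto simp: p_def)
  define e where "e = grad u x /\<^sub>R p"
  have e1: "norm e = 1" and ge: "grad u x = p *\<^sub>R e" using p by (auto simp: e_def p_def)
  obtain P d where P: "orthogonal_matrix P" "\<And>i. hessian u x *v column i P = d i *\<^sub>R column i P"
    using symmetric_orthonormal_eigenbasis[OF hessian_symmetric[OF C2 open_ball x]] by metis
  define w where "w y = u y - m + 1" for y
  define b where "b i = column i P" for i
  have bb: "b i \<bullet> b i = 1" for i using orthogonal_matrix_inner_columns[OF P(1)] by (simp add: b_def)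
  have nb: "norm (b i) = 1" for i using bb by (simp add: norm_eq_1)
  have Hb: "hessian u x *v b i = d i *\<^sub>R b i" for i using P by (simp add: b_def)
  have Hbe: "b i \<bullet> (hessian u x *v c) = d i * (b i \<bullet> c)" for i c
    using symmetric_dot[OF hessian_symmetric[OF C2 open_ball x], of "b i" c] by (simp add: Hb)
  define q where "q i t = eta (x + t *\<^sub>R b i) * (grad u (x + t *\<^sub>R b i) \<bullet> e) + A / 2 * (w (x + t *\<^sub>R b i))\<^sup>2" for i t
  define q' where "q' i t =
      - 2 * ((x + t *\<^sub>R b i) \<bullet> b i) * (grad u (x + t *\<^sub>R b i) \<bullet> e)
      + (b i \<bullet> (hessian u (x + t *\<^sub>R b i) *v e)) * eta (x + t *\<^sub>R b i)
      + A * (w (x + t *\<^sub>R b i) * (grad u (x + t *\<^sub>R b i) \<bullet> b i))" for i t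
  define \<delta> where "\<delta> = 1 - norm x"
  have \<delta>: "\<delta> > 0" using x by (simp add: \<delta>_def)
  have inball: "x + t *\<^sub>R b i \<in> ball 0 1" if "\<bar>t\<bar> < \<delta>" for t i
    using norm_triangle_ineq[of x "t *\<^sub>R b i"] that by (simp add: \<delta>_def nb)
  have dw: "((\<lambda>s. w (x + s *\<^sub>R b i)) has_real_derivative grad u (x + t *\<^sub>R b i) \<bullet> b i) (at t)"
    if "\<bar>t\<bar> < \<delta>" for i t
    unfolding w_def using line_derivative[OF C1' inball[OF that]] by (auto intro!: derivative_eq_intros)
  have dq: "(q i has_real_derivative q' i t) (at t)" if t: "\<bar>t\<bar> < \<delta>" for i t
    unfolding q_def q'_def
    by (rule DERIV_cong[OF DERIV_add[OF
          DERIV_mult'[OF eta_line_derivative[of x "b i" t] line_derivative_grad[OF C2 inball[OF t], where c = e]]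
          DERIV_cmult[OF DERIV_power[OF dw[OF t], where n = 2], of "A / 2"]]])
      (simp add: algebra_simps)
  have dq': "(q' i has_real_derivative (- 2 * p - 4 * (x \<bullet> b i) * d i * (b i \<bullet> e)
      + eta x * third_derivative u (b i) (b i) e x + A * p\<^sup>2 * (b i \<bullet> e)\<^sup>2 + A * w x * d i)) (at 0)" for i
  proof -
    have x0: "x + 0 *\<^sub>R b i \<in> ball 0 1" using x by simp
    have dxb: "((\<lambda>t. (x + t *\<^sub>R b i) \<bullet> b i) has_real_derivative 1) (at 0)"
    proof -
      have "(x + t *\<^sub>R b i) \<bullet> b i = x \<bullet> b i + t" for t by (simp add: inner_simps bb)
      then show ?thesis by (auto intro!: derivative_eq_intros)
    qed
    have ee: "e \<bullet> e = 1" using e1 by (simp add: norm_eq_1)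
    have w0: "((\<lambda>s. w (x + s *\<^sub>R b i)) has_real_derivative grad u (x + 0 *\<^sub>R b i) \<bullet> b i) (at 0)"
      using dw[of 0 i] \<delta> by simp
    note D = DERIV_add[OF DERIV_add[OF
            DERIV_mult'[OF DERIV_cmult[OF dxb, of "- 2"] line_derivative_grad[OF C2 x0, of e]]
            DERIV_mult'[OF line_derivative_hessian[OF C3 x0, of "b i" e] eta_line_derivative[of x "b i" 0]]]
            DERIV_cmult[OF DERIV_mult'[OF w0 line_derivative_grad[OF C2 x0, of "b i"]], of A]]
    show ?thesis
      unfolding q'_def
      by (rule DERIV_cong[OF D],
        unfold Hbe bb ge scaleR_zero_left add_0_right inner_scaleR_left ee inner_commute[of e "b i"])
        (simp add: algebra_simps power2_eq_square)
  qed
  have qmax: "q i t \<le> q i 0" if "\<bar>t\<bar> < \<delta>" for i t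
  proof -
    let ?y = "x + t *\<^sub>R b i"
    have "grad u ?y \<bullet> e \<le> norm (grad u ?y)"
      using norm_cauchy_schwarz[of "grad u ?y" e] e1 by simp
    then have "q i t \<le> Q ?y"
      using eta_pos[OF inball[OF that]] by (simp add: q_def Q_def w_def)
    also have "\<dots> \<le> Q x" by (rule max[OF inball[OF that]])
    also have "Q x = q i 0"
      using e1 p by (simp add: Q_def q_def w_def ge norm_eq_1)
    finally show ?thesis .
  qed
  note test = second_derivative_at_local_max[OF dq dq' \<delta> qmax]
  have w: "1 \<le> w x" "w x \<le> 1 + W" using u by (auto simp: w_def)
  have A: "A > 0" by (simp add: A_def n_def add_nonneg_pos)
  have *: "eta x * d i * (b i \<bullet> e) = 2 * (x \<bullet> b i) * p - (A * w x) * p * (b i \<bullet> e)" for i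
  proof -
    have "q' i 0 = 0" by (rule test(1)) auto
    moreover have "e \<bullet> e = 1" using e1 by (simp add: norm_eq_1)
    ultimately show ?thesis by (simp add: q'_def Hbe ge inner_commute[of e "b i"] algebra_simps)
  qed
  have lin: "grad \<phi> x \<bullet> e = (\<Sum>i\<in>UNIV. third_derivative u (b i) (b i) e x / (1 + (d i)\<^sup>2))"
    unfolding b_def by (rule linearized_equation[OF C3 open_ball x d\<phi> eq P])
  have second: "(\<Sum>i\<in>UNIV. (A * p\<^sup>2 * (b i \<bullet> e)\<^sup>2 + (A * w x) * d i - 4 * (x \<bullet> b i) * d i * (b i \<bullet> e) - 2 * p) / (1 + (d i)\<^sup>2))
      \<le> eta x * norm (grad \<phi> x)"
  proof -
    have "(\<Sum>i\<in>UNIV. (A * p\<^sup>2 * (b i \<bullet> e)\<^sup>2 + (A * w x) * d i - 4 * (x \<bullet> b i) * d i * (b i \<bullet> e) - 2 * p) / (1 + (d i)\<^sup>2))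
      \<le> (\<Sum>i\<in>UNIV. - eta x * (third_derivative u (b i) (b i) e x / (1 + (d i)\<^sup>2)))"
    proof (rule sum_mono)
      fix i
      have "- 2 * p - 4 * (x \<bullet> b i) * d i * (b i \<bullet> e) + eta x * third_derivative u (b i) (b i) e x
          + A * p\<^sup>2 * (b i \<bullet> e)\<^sup>2 + A * w x * d i \<le> 0"
        by (rule test(2)) auto
      then have "(A * p\<^sup>2 * (b i \<bullet> e)\<^sup>2 + (A * w x) * d i - 4 * (x \<bullet> b i) * d i * (b i \<bullet> e) - 2 * p) / (1 + (d i)\<^sup>2)
        \<le> (- eta x * third_derivative u (b i) (b i) e x) / (1 + (d i)\<^sup>2)"
        by (intro divide_right_mono) auto
      then show "(A * p\<^sup>2 * (b i \<bullet> e)\<^sup>2 + (A * w x) * d i - 4 * (x \<bullet> b i) * d i * (b i \<bullet> e) - 2 * p) / (1 + (d i)\<^sup>2)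
        \<le> - eta x * (third_derivative u (b i) (b i) e x / (1 + (d i)\<^sup>2))" by simp
    qed
    also have "\<dots> = eta x * - (grad \<phi> x \<bullet> e)" unfolding lin by (simp add: sum_distrib_left sum_negf)
    also have "\<dots> \<le> eta x * norm (grad \<phi> x)"
      using Cauchy_Schwarz_ineq2[of "grad \<phi> x" e] e1 eta by (intro mult_left_mono) auto
    finally show ?thesis .
  qed
  have sum_e: "(\<Sum>i\<in>UNIV. (b i \<bullet> e)\<^sup>2) = 1"
    using sum_inner_columns_squared[OF P(1)] e1 by (simp add: b_def)
  have xb: "\<bar>x \<bullet> b i\<bar> \<le> 1" for i
    using Cauchy_Schwarz_ineq2[of x "b i"] nb x by (simp add: less_imp_le order_trans)
  have ph: "\<phi> x = (\<Sum>i\<in>UNIV. arctan (d i)) - (n - 2) * (pi / 2)"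
    using eq[OF x] sum_eigenvalues[OF P, of arctan] by simp
  have bounds: "A \<le> A * w x" "A * w x \<le> B" using w A by (auto simp: B_def)
  note final = critical_point_inequality[OF sum_e xb eta p, folded n_def, folded A_def,
      OF bounds * ph \<phi> second, folded C1_def, folded C2_def, OF large[folded p_def]]
  show "\<phi> x / (eta x)\<^sup>2 \<le> 1 / (eta x * norm (grad u x))" using final(1) by (simp add: p_def)
  show "A * eta x / (4 * n * C1\<^sup>2) \<le> norm (grad \<phi> x)" by (rule final(2))
qed

lemma Ck_on_closure_bounded:
  assumes "Ck_on_closure k U g" "bounded U" "length is \<le> k"
  shows "bounded (partial_derivs is g ` U)"
proof -
  obtain h where h: "continuous_on (closure U) h" "\<And>x. x \<in> U \<Longrightarrow> h x = partial_derivs is g x"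
    using assms unfolding Ck_on_closure_def by blast
  have "compact (h ` closure U)"
    using h(1) assms(2) by (intro compact_continuous_image) (auto simp: compact_closure)
  then have "bounded (h ` U)"
    by (meson bounded_subset closure_subset compact_imp_bounded image_mono)
  also have "h ` U = partial_derivs is g ` U" using h(2) by (rule image_cong[OF refl])
  finally show ?thesis .
qed

lemma grad_bounded:
  fixes g :: "real^'n \<Rightarrow> real"
  assumes "Ck_on_closure k U g" "bounded U" "k \<ge> 1"
  obtains M where "\<And>x. x \<in> U \<Longrightarrow> norm (grad g x) \<le> M"
proof -
  have "\<exists>b. \<forall>x\<in>U. \<bar>partial_deriv i g x\<bar> \<le> b" for i
    using Ck_on_closure_bounded[OF assms(1,2), of "[i]"] assms(3) by (auto simp: bounded_iff)
  then obtain b where b: "\<And>i x. x \<in> U \<Longrightarrow> \<bar>partial_deriv i g x\<bar> \<le> b i" by metis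
  have "norm (grad g x) \<le> (\<Sum>i\<in>UNIV. b i)" if "x \<in> U" for x
  proof -
    have "norm (grad g x) \<le> (\<Sum>i\<in>UNIV. \<bar>grad g x $ i\<bar>)" by (rule norm_le_l1_cart)
    also have "\<dots> \<le> (\<Sum>i\<in>UNIV. b i)" by (intro sum_mono) (simp add: grad_def b that)
    finally show ?thesis .
  qed
  then show thesis by (rule that)
qed

lemma osc_bounds:
  assumes "bounded (g ` S)" "x \<in> S"
  shows "(INF x\<in>S. g x) \<le> g x" "g x \<le> (INF x\<in>S. g x) + osc S g"
  using assms by (auto simp: osc_def intro!: cINF_lower cSUP_upper bounded_imp_bdd_below bounded_imp_bdd_above)

text \<open>Smallness of \<open>f\<close> near \<open>0\<close> fixes a threshold \<open>T\<close> for \<open>\<eta> |Du|\<close> beyond which the two conclusions of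
\<open>interior_maximum_estimate\<close> contradict the hypothesis on \<open>D\<phi>\<close>. The bound \<open>K\<close> adds to \<open>T\<close> the largest
possible value of \<open>A/2 w\<^sup>2\<close>, so that \<open>|Du(0)| > K\<close> gives \<open>\<eta> |Du| > T\<close> wherever \<open>Q \<ge> Q(0)\<close>.\<close>

lemma gradient_bound_for_oscillation:
  fixes f :: "real \<Rightarrow> real" and \<omega> :: real
  assumes f: "mono_on {0..} f" "(f \<longlongrightarrow> 0) (at_right 0)"
  shows "\<exists>K. \<forall>(\<phi> :: real^'n \<Rightarrow> real) (u :: real^'n \<Rightarrow> real).
    (\<forall>x\<in>ball 0 1. \<phi> differentiable (at x)) \<longrightarrow>
    (\<forall>x\<in>ball 0 1. \<phi> x \<ge> 0) \<longrightarrow>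
    (\<forall>x\<in>ball 0 1. norm (grad \<phi> x) \<le> eta x * f (\<phi> x / (eta x)\<^sup>2)) \<longrightarrow>
    Ck_on_closure 3 (ball 0 1) u \<longrightarrow>
    (\<forall>x\<in>ball 0 1. (\<Sum>l\<in>#eigenvalues (hessian u x). arctan l) = \<phi> x + (real CARD('n) - 2) * (pi / 2)) \<longrightarrow>
    osc (ball 0 1) u = \<omega> \<longrightarrow>
    norm (grad u 0) \<le> K"
proof -
  define n where "n = real CARD('n)"
  define A where "A = 2 * n + 1"
  \<comment> \<open>The maximum only ensures positive constants for values \<open>\<omega>\<close> that no oscillation takes.\<close>
  define W where "W = max 0 \<omega>"
  define B where "B = A * (1 + W)"
  define C1 where "C1 = B + 2 * n"
  define C2 where "C2 = n * (2 + 4 * (2 + B)) + B * C1"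
  have n: "n \<ge> 1" by (simp add: n_def Suc_leI)
  have A: "A > 0" using n by (simp add: A_def)
  have "B > 0" using A by (simp add: B_def W_def add_pos_nonneg)
  then have C1: "C1 > 0" using n by (simp add: C1_def)
  define \<epsilon> where "\<epsilon> = A / (4 * n * C1\<^sup>2)"
  have "\<epsilon> > 0" using A n C1 by (simp add: \<epsilon>_def)
  then have "eventually (\<lambda>t. f t < \<epsilon>) (at_right 0)" using order_tendstoD(2)[OF f(2)] by blast
  then obtain s where s: "s > 0" "\<And>t. 0 < t \<Longrightarrow> t < s \<Longrightarrow> f t < \<epsilon>"
    by (auto simp: eventually_at_right_field)
  define T where "T = max 1 (max (2 * n * C2 / A) (1 / s))"
  have T: "T \<ge> 1" "2 * n * C2 / A \<le> T" "1 / s \<le> T" by (auto simp: T_def)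
  define K where "K = T + A / 2 * (1 + W)\<^sup>2"
  have "norm (grad u 0) \<le> K"
    if d\<phi>: "\<And>x. x \<in> ball 0 1 \<Longrightarrow> \<phi> differentiable (at x)"
      and \<phi>: "\<And>x. x \<in> ball 0 1 \<Longrightarrow> \<phi> x \<ge> 0"
      and grad\<phi>: "\<And>x. x \<in> ball 0 1 \<Longrightarrow> norm (grad \<phi> x) \<le> eta x * f (\<phi> x / (eta x)\<^sup>2)"
      and u: "Ck_on_closure 3 (ball 0 1) u"
      and eq: "\<And>x. x \<in> ball 0 1 \<Longrightarrow> (\<Sum>l\<in>#eigenvalues (hessian u x). arctan l) = \<phi> x + (n - 2) * (pi / 2)"
      and osc: "osc (ball 0 1) u = \<omega>"
    for \<phi> u :: "real^'n \<Rightarrow> real"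
  proof (rule ccontr)
    assume "\<not> ?thesis"
    then have big: "norm (grad u 0) > K" by simp
    have C3: "Ck_on 3 (ball 0 1) u" using u by (simp add: Ck_on_closure_def)
    define m where "m = (INF x\<in>ball 0 1. u x)"
    have bdd: "bounded (u ` ball 0 1)"
      using Ck_on_closure_bounded[OF u, of "[]"] by simp
    have ub: "m \<le> u x" "u x \<le> m + W" if "x \<in> ball 0 1" for x
      using osc_bounds[OF bdd that] osc by (auto simp: m_def W_def)
    obtain M where M: "\<And>x. x \<in> ball 0 1 \<Longrightarrow> norm (grad u x) \<le> M"
      using grad_bounded[OF u] by auto
    define Q where "Q x = eta x * norm (grad u x) + A / 2 * (u x - m + 1)\<^sup>2" for x
    have sq: "0 \<le> A / 2 * (u x - m + 1)\<^sup>2" "A / 2 * (u x - m + 1)\<^sup>2 \<le> A / 2 * (1 + W)\<^sup>2" if "x \<in> ball 0 1" for x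
      using ub[OF that] A by (auto intro!: mult_left_mono power_mono)
    have Q0: "Q 0 > K" using big sq(1)[of 0] by (simp add: Q_def eta_def)
    have contact: "T < eta x * norm (grad u x)" if "x \<in> ball 0 1" "Q 0 \<le> Q x" for x
      using that Q0 sq(2)[OF that(1)] by (simp add: Q_def K_def)
    have MT: "M > T"
    proof -
      have "T < norm (grad u 0)" using contact[of 0] by (simp add: eta_def)
      also have "\<dots> \<le> M" using M[of 0] by simp
      finally show ?thesis .
    qed
    define r where "r = sqrt (1 - T / M)"
    have r: "0 \<le> r" "r < 1" "r\<^sup>2 = 1 - T / M" using MT T by (auto simp: r_def)
    \<comment> \<open>The gradient bound \<open>M\<close> only keeps these points away from the sphere, where \<open>\<eta> = 0\<close>; it does not enter \<open>K\<close>.\<close>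
    have contin: "norm x \<le> r" if "x \<in> ball 0 1" "Q 0 \<le> Q x" for x
    proof -
      have "0 < eta x" using that(1) by (simp add: eta_def abs_square_less_1)
      then have "T < eta x * M"
        using contact[OF that] mult_left_mono[OF M[OF that(1)], of "eta x"] by linarith
      then have "M * (norm x)\<^sup>2 \<le> M - T" by (simp add: eta_def algebra_simps)
      also have "M - T = M * r\<^sup>2" using MT T r(3) by (simp add: field_simps)
      finally have "M * (norm x)\<^sup>2 \<le> M * r\<^sup>2" .
      then have "(norm x)\<^sup>2 \<le> r\<^sup>2" using MT T by simp
      then show ?thesis using r(1) by (rule power2_le_imp_le)
    qed
    have contQ: "continuous_on (cball 0 r) Q"
    proof -
      have "continuous_on (ball 0 1) (partial_deriv i u)" for i
        by (rule Ck_on_continuous[OF Ck_on_partial_deriv[of 2]]) (use C3 in simp)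
      then have "continuous_on (ball 0 1) (grad u)"
        unfolding grad_def by (intro continuous_on_vec_lambda)
      then have "continuous_on (ball 0 1) Q"
        unfolding Q_def eta_def by (intro continuous_intros Ck_on_continuous[OF C3])
      then show ?thesis by (rule continuous_on_subset) (use r in auto)
    qed
    obtain x where xr: "x \<in> cball 0 r" and xmax: "\<And>y. y \<in> cball 0 r \<Longrightarrow> Q y \<le> Q x"
      using continuous_attains_sup[OF compact_cball _ contQ] r(1) by force
    have x: "x \<in> ball 0 1" using xr r by auto
    have Q0x: "Q 0 \<le> Q x" using xmax r(1) by simp
    have max: "Q y \<le> Q x" if "y \<in> ball 0 1" for y
      using xmax[of y] contin[OF that] Q0x by force
    define \<eta>p where "\<eta>p = eta x * norm (grad u x)"
    have \<eta>p: "\<eta>p > T" using contact[OF x Q0x] by (simp add: \<eta>p_def)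
    have eta: "eta x > 0" using x by (simp add: eta_def abs_square_less_1)
    have "2 * n * C2 \<le> A * T" using T(2) A by (simp add: field_simps)
    also have "\<dots> \<le> A * \<eta>p" using \<eta>p A by simp
    finally have large: "2 * n * C2 \<le> A * \<eta>p" .
    have one: "1 \<le> \<eta>p" using \<eta>p T(1) by simp
    note est = interior_maximum_estimate[OF C3 x d\<phi>[OF x], folded n_def, OF eq \<phi>[OF x] ub[OF x],
        folded A_def, folded B_def, folded C1_def, folded C2_def, folded Q_def \<eta>p_def, OF _ max one large]
    have "1 / \<eta>p < s" using s(1) \<eta>p T by (simp add: field_simps) (smt (verit) mult_strict_right_mono)
    then have "f (1 / \<eta>p) < \<epsilon>" using s(2) one by simp
    moreover have "f (\<phi> x / (eta x)\<^sup>2) \<le> f (1 / \<eta>p)"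
      using f(1) by (rule mono_onD) (use \<phi>[OF x] est(1) one in auto)
    ultimately have "eta x * f (\<phi> x / (eta x)\<^sup>2) < eta x * \<epsilon>" using eta by simp
    also have "\<dots> = A * eta x / (4 * n * C1\<^sup>2)" by (simp add: \<epsilon>_def)
    also have "\<dots> \<le> norm (grad \<phi> x)" using est(2) by simp
    finally show False using grad\<phi>[OF x] by simp
  qed
  then show ?thesis unfolding n_def by blast
qed

theorem mainTheorem3:
  fixes f :: "real \<Rightarrow> real"
  assumes "\<And>t. t \<ge> 0 \<Longrightarrow> f t \<ge> 0"
    and "mono_on {0..} f"
    and "f 0 = 0"
    and "(f \<longlongrightarrow> 0) (at_right 0)"
  shows "\<exists>C :: real \<Rightarrow> real. \<forall>(\<psi> :: real^'n \<Rightarrow> real) (\<phi> :: real^'n \<Rightarrow> real) (u :: real^'n \<Rightarrow> real).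
    Ck_on 1 (ball 0 1) \<psi> \<longrightarrow>
    (\<forall>x. \<phi> x = \<psi> x - (real CARD('n) - 2) * (pi / 2)) \<longrightarrow>
    (\<forall>x\<in>ball 0 1. \<phi> x \<ge> 0) \<longrightarrow>
    (\<forall>x\<in>ball 0 1. norm (grad \<phi> x) \<le> eta x * f (\<phi> x / (eta x)\<^sup>2)) \<longrightarrow>
    Ck_on_closure 3 (ball 0 1) u \<longrightarrow>
    (\<forall>x\<in>ball 0 1. (\<Sum>l\<in>#eigenvalues (hessian u x). arctan l) = \<psi> x) \<longrightarrow>
    norm (grad u 0) \<le> C (osc (ball 0 1) u)"
proof -
  obtain C :: "real \<Rightarrow> real" where C: "\<And>\<omega> (\<phi> :: real^'n \<Rightarrow> real) (u :: real^'n \<Rightarrow> real).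
    (\<forall>x\<in>ball 0 1. \<phi> differentiable (at x)) \<longrightarrow>
    (\<forall>x\<in>ball 0 1. \<phi> x \<ge> 0) \<longrightarrow>
    (\<forall>x\<in>ball 0 1. norm (grad \<phi> x) \<le> eta x * f (\<phi> x / (eta x)\<^sup>2)) \<longrightarrow>
    Ck_on_closure 3 (ball 0 1) u \<longrightarrow>
    (\<forall>x\<in>ball 0 1. (\<Sum>l\<in>#eigenvalues (hessian u x). arctan l) = \<phi> x + (real CARD('n) - 2) * (pi / 2)) \<longrightarrow>
    osc (ball 0 1) u = \<omega> \<longrightarrow> norm (grad u 0) \<le> C \<omega>"
    using gradient_bound_for_oscillation[OF assms(2,4), where 'n = 'n] by metis
  show ?thesis
  proof (intro exI allI impI)
    fix \<psi> \<phi> u :: "real^'n \<Rightarrow> real"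
    assume \<psi>: "Ck_on 1 (ball 0 1) \<psi>"
      and \<phi>\<psi>: "\<forall>x. \<phi> x = \<psi> x - (real CARD('n) - 2) * (pi / 2)"
      and rest: "\<forall>x\<in>ball 0 1. \<phi> x \<ge> 0"
        "\<forall>x\<in>ball 0 1. norm (grad \<phi> x) \<le> eta x * f (\<phi> x / (eta x)\<^sup>2)"
        "Ck_on_closure 3 (ball 0 1) u"
        "\<forall>x\<in>ball 0 1. (\<Sum>l\<in>#eigenvalues (hessian u x). arctan l) = \<psi> x"
    have \<phi>_eq: "\<phi> = (\<lambda>x. \<psi> x - (real CARD('n) - 2) * (pi / 2))" using \<phi>\<psi> by auto
    have "\<forall>x\<in>ball 0 1. \<phi> differentiable (at x)"
      unfolding \<phi>_eq using Ck_on_differentiable[OF \<psi>] by (auto intro!: derivative_intros)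
    then show "norm (grad u 0) \<le> C (osc (ball 0 1) u)"
      using C rest \<phi>\<psi> by simp
  qed
qed

end
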